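(* Consider the game, demonstrations, data matrices and identification described in the context, where $\mathcal X$ is compact. Assume that for all $i\in\mathcal N$: $R_{ij}^*$ is diagonal for all $j\in\mathcal N$; $V_i^*(x)={\theta_i^*}^\top\phi_i(x)$ with $\phi_i:\mathbb R^n\to\mathbb R^{h_i}$ twice continuously differentiable on $\mathcal X$, $\theta_i^*\in\mathbb R^{h_i}$; $f,G_i,\psi_i,\phi_i$ are known; $D$, the initial states $x^{*(d)}(t_0)$, $K$, $\Delta t$ are chosen such that $\operatorname{rank}(M_{u_i})\le p_i\bar h_i$ is the highest possible (further data points do not increase it), and $\operatorname{rank}(M_{u_i})<p_i\bar h_i$; and the points $x_1,\dots,x_{\bar K}\in\mathcal X$ are chosen such that $\operatorname{rank}(M_{\mathrm{HJB}_i})\le p+m_i+h_i$ is the highest possible (further data points do not increase it). Suppose that $Q_i^*$ is not a linear combination of the components of $\psi_i$, but that the basis functions $\psi_i:\mathbb R^n\to\mathbb R^{m_i}$, $i\in\mathcal N$, are from a subalgebra of the set of bounded and continuously differentiable functions on $\mathcal X$ that fulfills the conditions of the Stone–Weierstrass theorem. Then a bounded, continuously differentiable function $\varepsilon_i:\mathcal X\to\mathbb R$ exists such that for all $x\in\mathcal X$, $Q_i^*(x)={\beta_i^*}^\top\psi_i(x)+\varepsilon_i(x)$, where the parameters $\alpha_i^*,\beta_i^*,\theta_i^*$ fulfill for all $i\in\mathcal N$ $$\begin{bmatrix}{\mu^*}^\top\odot{\mu^*}^\top&\psi_i^\top&\big(\tfrac{\partial\phi_i}{\partial x}f_g^*\big)^\top\end{bmatrix}\begin{bmatrix}\alpha_i^*\\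 \beta_i^*\\ \theta_i^*\end{bmatrix}=-\varepsilon_i(x),\qquad f_g^*=f+\sum_{j=1}^NG_j\mu_j^*.$$ Let $\hat\alpha_i,\hat\beta_i$, $i\in\mathcal N$ (where $\hat\beta_i=\beta_i^*$, since $\beta_i^*$ and $\varepsilon_i$ are only defined after the HJB-based identification), be determined by $$\begin{bmatrix}\hat\alpha_i\\ \hat\beta_i\end{bmatrix}=L_i\bar M_{\mathrm{HJB}_i}^{+}M_{\mathrm{HJB}_i}^{\top}z_{\mathrm{HJB}_i}+L_i\Big(I-\bar M_{\mathrm{HJB}_i}^{+}\bar M_{\mathrm{HJB}_i}\Big)\bar w_i,$$ with $\mu_i^*$ identified by $\hat\mu_i$, and let a differential game of the type in the context with $\hat Q_i(x)=\hat\beta_i^\top\psi_i(x)$ and control weights given by $\hat\alpha_i$, $i\in\mathcal N$, be defined such that it has a unique feedback Nash equilibrium (FNE) $\{\hat\mu_i^*:i\in\mathcal N\}$ with corresponding value functions $\hat V_i^*(x)=\hat\theta_i^{*\top}\phi_i(x)$. Then, in general, $\mu_i^*(x)\ne\hat\mu_i^*(x)$ for all $i\in\mathcal N$; that is, these hypotheses do not guarantee that the FNE $\{\hat\mu_i^*\}$ coincides with $\{\mu_i^*\}$.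
   Context: **Game.** Dynamics $\dot x=f(x)+\sum_{i=1}^N G_i(x)u_i$, $x\in\mathbb R^n$, $u_i\in\mathbb R^{p_i}$, $i\in\mathcal N=\{1,\dots,N\}$, $N\ge1$, $p=\sum_i p_i$; $f:\mathbb R^n\to\mathbb R^n$ ($f(0)=0$) and $G_i:\mathbb R^n\to\mathbb R^{n\times p_i}$ are continuously differentiable on a neighborhood $\mathcal X\subset\mathbb R^n$ of the origin. Player $i$ uses an admissible feedback strategy $u_i=\mu_i(x)$, $\mu_i\in\Gamma_i(\mathcal X)$: $\mu_i:\mathbb R^n\to\mathbb R^{p_i}$, $\mu_i(0)=0$, is continuously differentiable on $\mathcal X$, and $\mu=[\mu_1^\top\cdots\mu_N^\top]^\top$ stabilizes the system on $\mathcal X$ and leads, for all $t\ge t_0$ and all $x(t_0)\in\mathcal X$, to a finite value function $V_i^\mu(x)=\int_t^\infty Q_i^*(x)+\sum_{j=1}^N\mu_j^\top R_{ij}^*\mu_j\,d\tau$ that is twice continuously differentiable on $\mathcal X$. Here $R_{ij}^*\succeq0$ ($i\ne j$), $R_{ii}^*\succ0$, and $Q_i^*$ is positive definite and continuously differentiable. An FNE is a tuple $\{\mu_i^*\in\Gamma_i(\mathcal X)\}$ with $V_i^*=V_i^{\mu^*}\le V_i^{\mu^*_{-i}}$ for all $i$, where $\mu^*_{-i}$ is $\mu^*$ with $\mu_i^*$ replaced by any $\mu_i$. Standing assumptions: there is a unique FNE, and the coupled HJB equations $$0=\tfrac{\partial V_i^*}{\partial x}\Big(f+\sum_jG_j\mu_j^*\Big)+\sum_j{\mu_j^*}^\top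 R_{ij}^*\mu_j^*+Q_i^*(x),\quad \mu_i^*(x)=-\tfrac12{R_{ii}^*}^{-1}G_i(x)^\top\Big(\tfrac{\partial V_i^*}{\partial x}\Big)^\top,\quad i\in\mathcal N,$$ are necessary and sufficient for the FNE. $D\ge1$ trajectories $x^{*(d)}(t_0\to\infty)$, $u^{*(d)}(t_0\to\infty)$ of the FNE are given. **Stone–Weierstrass conditions.** $\mathcal X$ compact; the real subalgebra separates the points of $\mathcal X$ and contains for each $x\in\mathcal X$ a function not vanishing at $x$. **Splitting the value basis.** Reorder $\phi_i^\top=[\phi_i^{(r)\top}\ \phi_i^{(-r)\top}]$ with $\phi_i^{(r)}$ having $\bar h_i$ components, so that $G_i(x)^\top(\partial\phi^{(-r)}_{i,j}/\partial x)^\top=0$ for all $x\in\mathcal X$ and all $j$, while for each $j\in\{1,\dots,\bar h_i\}$, $G_i^\top(\partial\phi^{(r)}_{i,j}/\partial x)^\top$ is not identically zero on $\mathcal X$. $\Phi_i^{(r)}(x)=G_i(x)^\top(\partial\phi_i^{(r)}/\partial x)^\top$ has rows $\bar\phi^{(r)}_{i,1}(x)^\top,\dots,\bar\phi^{(r)}_{i,p_i}(x)^\top$; $\bar\Phi_i(x)\in\mathbb R^{p_i\times p_i\bar h_i}$ is the block-diagonal matrix whose $k$-th row is $[0_{1\times(k-1)\bar h_i}\ \ \bar\phi^{(r)}_{i,k}(x)^\top\ \ 0_{1\times(p_i-k)\bar h_i}]$. **FNE identification.** $K\ge1$ samples with step $\Delta t$ are taken from each demonstration; $M_{u_i}$ stacks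 $-\tfrac12\bar\Phi_i(x^{*(d)}(t_0+k\Delta t))$ and $z_{u_i}$ stacks $u_i^{*(d)}(t_0+k\Delta t)$, $d=1,\dots,D$, $k=0,\dots,K-1$. $\hat{\bar\theta}_i=(M_{u_i}^\top M_{u_i})^+M_{u_i}^\top z_{u_i}$ and $\hat\mu_i(x)=-\tfrac12\bar\Phi_i(x)\hat{\bar\theta}_i$. $(\cdot)^+$ is the Moore–Penrose inverse. **HJB data.** $\alpha_i^*\in\mathbb R^p$ collects the diagonal entries of $R_{i1}^*,\dots,R_{iN}^*$ in order; likewise $\hat\alpha_i$ for $\hat R_{ij}$. With $\hat\mu=[\hat\mu_1^\top\cdots\hat\mu_N^\top]^\top$, $\hat f_g=f+\sum_jG_j\hat\mu_j$, Hadamard product $\odot$: $m_{\mathrm{HJB}_i}(x)^\top=[\hat\mu^\top\odot\hat\mu^\top\ \ \psi_i^\top\ \ (\tfrac{\partial\phi_i}{\partial x}\hat f_g)^\top]$, $z_{\mathrm{HJB}_i}(x)=0$; $M_{\mathrm{HJB}_i}$, $z_{\mathrm{HJB}_i}$ stack these rows at $x_1,\dots,x_{\bar K}\in\mathcal X$. $\bar M_{\mathrm{HJB}_i}=M_{\mathrm{HJB}_i}^\top M_{\mathrm{HJB}_i}$, $L_i=[I_{p+m_i}\ 0_{(p+m_i)\times h_i}]$, $\bar w_i\in\mathbb R^{p+m_i+h_i}$. *)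

theory Defs
  imports
    "HOL-Analysis.Analysis"
    "Jordan_Normal_Form.DL_Rank"
    "Jordan_Normal_Form.Gauss_Jordan_Elimination"
begin

text \<open>
  The state lives in \<open>real ^ 'n\<close>. All player-dependent dimensions are natural numbers, so
  controls, basis vectors and data matrices use the dimension-carrying \<open>vec\<close> and \<open>mat\<close> of
  Jordan Normal Form. Players, components and samples are indexed from 0.
\<close>

no_notation vec_nth (infixl \<open>$\<close> 90)

section \<open>Smoothness on a set\<close>

text \<open>
  Smoothness on a set that need not be open means smoothness on some open superset; in this way
  the derivative at a boundary point is the ordinary one.
\<close>

definition C1_on :: "'a::real_normed_vector set \<Rightarrow> ('a \<Rightarrow> 'b::real_normed_vector) \<Rightarrow> bool" where
  "C1_on X g \<longleftrightarrow>
     (\<exists>U g'. open U \<and> X \<subseteq> U \<and> continuous_on U g' \<and>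
        (\<forall>x\<in>U. (g has_derivative blinfun_apply (g' x)) (at x)))"

definition C2_on :: "'a::real_normed_vector set \<Rightarrow> ('a \<Rightarrow> 'b::real_normed_vector) \<Rightarrow> bool" where
  "C2_on X g \<longleftrightarrow>
     (\<exists>U g'. open U \<and> X \<subseteq> U \<and> C1_on U g' \<and>
        (\<forall>x\<in>U. (g has_derivative blinfun_apply (g' x)) (at x)))"

definition SW_subalgebra :: "'a::real_normed_vector set \<Rightarrow> ('a \<Rightarrow> real) set \<Rightarrow> bool" where
  "SW_subalgebra X A \<longleftrightarrow>
     A \<subseteq> {g. bounded (g ` X) \<and> C1_on X g} \<and>
     (\<forall>g\<in>A. \<forall>h\<in>A. (\<lambda>x. g x + h x) \<in> A \<and> (\<lambda>x. g x * h x) \<in> A) \<and>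
     (\<forall>g\<in>A. \<forall>c. (\<lambda>x. c * g x) \<in> A) \<and>
     (\<forall>x\<in>X. \<forall>y\<in>X. x \<noteq> y \<longrightarrow> (\<exists>g\<in>A. g x \<noteq> g y)) \<and>
     (\<forall>x\<in>X. \<exists>g\<in>A. g x \<noteq> 0)"

section \<open>Matrices\<close>

definition sym_psd :: "nat \<Rightarrow> real mat \<Rightarrow> bool" where
  "sym_psd n A \<longleftrightarrow> A \<in> carrier_mat n n \<and> transpose_mat A = A \<and>
     (\<forall>v\<in>carrier_vec n. 0 \<le> scalar_prod v (A *\<^sub>v v))"

definition sym_pd :: "nat \<Rightarrow> real mat \<Rightarrow> bool" where
  "sym_pd n A \<longleftrightarrow> A \<in> carrier_mat n n \<and> transpose_mat A = A \<and>
     (\<forall>v\<in>carrier_vec n. v \<noteq> 0\<^sub>v n \<longrightarrow> 0 < scalar_prod v (A *\<^sub>v v))"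

definition mp_inverse :: "real mat \<Rightarrow> real mat" where
  "mp_inverse A = (THE B. B \<in> carrier_mat (dim_col A) (dim_row A) \<and>
     A * B * A = A \<and> B * A * B = B \<and>
     transpose_mat (A * B) = A * B \<and> transpose_mat (B * A) = B * A)"

definition mat_rank :: "real mat \<Rightarrow> nat" where
  "mat_rank A = vec_space.rank (dim_row A) A"

definition hadamard :: "real vec \<Rightarrow> real vec \<Rightarrow> real vec" where
  "hadamard v w = Matrix.vec (dim_vec v) (\<lambda>k. v $ k * w $ k)"

definition stack_vecs :: "real vec list \<Rightarrow> real vec" where
  "stack_vecs vs = vec_of_list (concat (map list_of_vec vs))"

section \<open>Differential games\<close>

text \<open>
  \<open>in_col g i x k\<close> is the \<open>k\<close>-th column of the input matrix \<open>G\<^sub>i(x)\<close>, and \<open>ctrl_cost g i j\<close> is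
  \<open>R\<^sub>i\<^sub>j\<close>, the weight of player \<open>j\<close>'s control in the cost of player \<open>i\<close>.
\<close>

record 'n game =
  nplayers :: nat
  t_init :: real
  region :: "(real ^ 'n) set"
  cdim :: "nat \<Rightarrow> nat"
  drift :: "real ^ 'n \<Rightarrow> real ^ 'n"
  in_col :: "nat \<Rightarrow> real ^ 'n \<Rightarrow> nat \<Rightarrow> real ^ 'n"
  state_cost :: "nat \<Rightarrow> real ^ 'n \<Rightarrow> real"
  ctrl_cost :: "nat \<Rightarrow> nat \<Rightarrow> real mat"

type_synonym 'n strategies = "nat \<Rightarrow> real ^ 'n \<Rightarrow> real vec"

definition cdim_total :: "'n::finite game \<Rightarrow> nat" where
  "cdim_total g = (\<Sum>i<nplayers g. cdim g i)"

definition input :: "'n::finite game \<Rightarrow> nat \<Rightarrow> real ^ 'n \<Rightarrow> real vec \<Rightarrow> real ^ 'n" where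
  "input g i x u = (\<Sum>k<cdim g i. u $ k *\<^sub>R in_col g i x k)"

text \<open>The vector \<open>G\<^sub>i(x)\<^sup>T (\<partial>W/\<partial>x)\<^sup>T\<close> for a scalar function \<open>W\<close>.\<close>

definition input_grad :: "'n::finite game \<Rightarrow> nat \<Rightarrow> (real ^ 'n \<Rightarrow> real) \<Rightarrow> real ^ 'n \<Rightarrow> real vec" where
  "input_grad g i W x =
     Matrix.vec (cdim g i) (\<lambda>k. frechet_derivative W (at x) (in_col g i x k))"

definition closed_loop :: "'n::finite game \<Rightarrow> 'n strategies \<Rightarrow> real ^ 'n \<Rightarrow> real ^ 'n" where
  "closed_loop g \<mu> x = drift g x + (\<Sum>j<nplayers g. input g j x (\<mu> j x))"

definition ctrl_penalty :: "'n::finite game \<Rightarrow> 'n strategies \<Rightarrow> nat \<Rightarrow> real ^ 'n \<Rightarrow> real" where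
  "ctrl_penalty g \<mu> i x =
     (\<Sum>j<nplayers g. scalar_prod (\<mu> j x) (ctrl_cost g i j *\<^sub>v \<mu> j x))"

text \<open>
  The data of the game are regular on the region only, so the closed loop is considered there:
  trajectories are solutions that start and stay in the region.
\<close>

definition trajectory :: "'n::finite game \<Rightarrow> 'n strategies \<Rightarrow> (real \<Rightarrow> real ^ 'n) \<Rightarrow> bool" where
  "trajectory g \<mu> x \<longleftrightarrow>
     (\<forall>t\<ge>t_init g. x t \<in> region g \<and>
        (x has_vector_derivative closed_loop g \<mu> (x t)) (at t within {t_init g..}))"

definition stabilizing :: "'n::finite game \<Rightarrow> 'n strategies \<Rightarrow> bool" where
  "stabilizing g \<mu> \<longleftrightarrow>
     (\<forall>x0\<in>region g. \<exists>x. trajectory g \<mu> x \<and> x (t_init g) = x0) \<and>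
     (\<forall>x. trajectory g \<mu> x \<longrightarrow> (x \<longlongrightarrow> 0) at_top) \<and>
     (\<forall>e>0. \<exists>d>0. \<forall>x. trajectory g \<mu> x \<and> norm (x (t_init g)) < d \<longrightarrow>
        (\<forall>t\<ge>t_init g. norm (x t) < e))"

text \<open>
  A value function is determined by the game on the region only; \<open>V\<close> is a \<open>C\<^sup>2\<close> function
  on the whole space whose restriction to the region is the cost-to-go.
\<close>

definition value_function ::
  "'n::finite game \<Rightarrow> 'n strategies \<Rightarrow> nat \<Rightarrow> (real ^ 'n \<Rightarrow> real) \<Rightarrow> bool" where
  "value_function g \<mu> i V \<longleftrightarrow> C2_on (region g) V \<and>
     (\<forall>x. trajectory g \<mu> x \<longrightarrow> (\<forall>t\<ge>t_init g.
        ((\<lambda>\<tau>. state_cost g i (x \<tau>) + ctrl_penalty g \<mu> i (x \<tau>)) has_integral V (x t)) {t..}))"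

definition admissible :: "'n::finite game \<Rightarrow> 'n strategies \<Rightarrow> bool" where
  "admissible g \<mu> \<longleftrightarrow>
     (\<forall>i<nplayers g. (\<forall>x. \<mu> i x \<in> carrier_vec (cdim g i)) \<and> \<mu> i 0 = 0\<^sub>v (cdim g i) \<and>
        (\<forall>k<cdim g i. C1_on (region g) (\<lambda>x. \<mu> i x $ k))) \<and>
     stabilizing g \<mu> \<and>
     (\<forall>i<nplayers g. \<exists>V. value_function g \<mu> i V)"

definition is_FNE :: "'n::finite game \<Rightarrow> 'n strategies \<Rightarrow> bool" where
  "is_FNE g \<mu> \<longleftrightarrow> admissible g \<mu> \<and>
     (\<forall>i<nplayers g. \<forall>\<nu> V W.
        admissible g (\<mu>(i := \<nu>)) \<and> value_function g \<mu> i V \<and> value_function g (\<mu>(i := \<nu>)) i W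
          \<longrightarrow> (\<forall>x\<in>region g. V x \<le> W x))"

definition unique_FNE :: "'n::finite game \<Rightarrow> bool" where
  "unique_FNE g \<longleftrightarrow> (\<exists>\<mu>. is_FNE g \<mu> \<and>
     (\<forall>\<nu>. is_FNE g \<nu> \<longrightarrow> (\<forall>i<nplayers g. \<forall>x\<in>region g. \<nu> i x = \<mu> i x)))"

definition coupled_HJB ::
  "'n::finite game \<Rightarrow> 'n strategies \<Rightarrow> (nat \<Rightarrow> real ^ 'n \<Rightarrow> real) \<Rightarrow> bool" where
  "coupled_HJB g \<mu> V \<longleftrightarrow> (\<forall>i<nplayers g. \<forall>x\<in>region g.
     0 = frechet_derivative (V i) (at x) (closed_loop g \<mu> x)
           + ctrl_penalty g \<mu> i x + state_cost g i x \<and>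
     \<mu> i x = (- 1 / 2) \<cdot>\<^sub>v (the (mat_inverse (ctrl_cost g i i)) *\<^sub>v input_grad g i (V i) x))"

definition HJB_characterizes_FNE :: "'n::finite game \<Rightarrow> bool" where
  "HJB_characterizes_FNE g \<longleftrightarrow> (\<forall>\<mu> V.
     admissible g \<mu> \<and> (\<forall>i<nplayers g. value_function g \<mu> i (V i)) \<longrightarrow>
       (is_FNE g \<mu> \<longleftrightarrow> coupled_HJB g \<mu> V))"

definition differential_game :: "'n::finite game \<Rightarrow> bool" where
  "differential_game g \<longleftrightarrow>
     1 \<le> nplayers g \<and> (\<forall>i<nplayers g. 1 \<le> cdim g i) \<and>
     0 \<in> interior (region g) \<and>
     drift g 0 = 0 \<and> C1_on (region g) (drift g) \<and>
     (\<forall>i<nplayers g. \<forall>k<cdim g i. C1_on (region g) (\<lambda>x. in_col g i x k)) \<and>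
     (\<forall>i<nplayers g. C1_on (region g) (state_cost g i) \<and> state_cost g i 0 = 0 \<and>
        (\<forall>x\<in>region g. x \<noteq> 0 \<longrightarrow> 0 < state_cost g i x)) \<and>
     (\<forall>i<nplayers g. \<forall>j<nplayers g. sym_psd (cdim g j) (ctrl_cost g i j)) \<and>
     (\<forall>i<nplayers g. sym_pd (cdim g i) (ctrl_cost g i i)) \<and>
     unique_FNE g \<and> HJB_characterizes_FNE g"

text \<open>All players' controls at \<open>x\<close>, and the diagonals of \<open>R\<^sub>i\<^sub>1, \<dots>, R\<^sub>i\<^sub>N\<close>, each as one vector.\<close>

definition stacked_ctrl :: "'n::finite game \<Rightarrow> 'n strategies \<Rightarrow> real ^ 'n \<Rightarrow> real vec" where
  "stacked_ctrl g \<mu> x = stack_vecs (map (\<lambda>j. \<mu> j x) [0..<nplayers g])"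

definition weight_diag :: "'n::finite game \<Rightarrow> nat \<Rightarrow> real vec" where
  "weight_diag g i = vec_of_list (concat (map (\<lambda>j. diag_mat (ctrl_cost g i j)) [0..<nplayers g]))"

section \<open>Basis functions\<close>

text \<open>
  \<open>phi b i\<close> is already ordered: its first \<open>hrel b i\<close> components are the ones that influence the
  strategy of player \<open>i\<close> (see \<open>split_basis\<close>).
\<close>

record 'n basis_data =
  hdim :: "nat \<Rightarrow> nat"
  hrel :: "nat \<Rightarrow> nat"
  mdim :: "nat \<Rightarrow> nat"
  phi :: "nat \<Rightarrow> real ^ 'n \<Rightarrow> real vec"
  psi :: "nat \<Rightarrow> real ^ 'n \<Rightarrow> real vec"

definition phi_dir :: "'n::finite basis_data \<Rightarrow> nat \<Rightarrow> real ^ 'n \<Rightarrow> real ^ 'n \<Rightarrow> real vec" where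
  "phi_dir b i x v =
     Matrix.vec (hdim b i) (\<lambda>j. frechet_derivative (\<lambda>y. phi b i y $ j) (at x) v)"

definition split_basis :: "'n::finite game \<Rightarrow> 'n basis_data \<Rightarrow> nat \<Rightarrow> bool" where
  "split_basis g b i \<longleftrightarrow> hrel b i \<le> hdim b i \<and>
     (\<forall>j<hrel b i. \<exists>x\<in>region g. input_grad g i (\<lambda>y. phi b i y $ j) x \<noteq> 0\<^sub>v (cdim g i)) \<and>
     (\<forall>j\<in>{hrel b i..<hdim b i}. \<forall>x\<in>region g.
        input_grad g i (\<lambda>y. phi b i y $ j) x = 0\<^sub>v (cdim g i))"

text \<open>The block-diagonal matrix whose \<open>k\<close>-th block is the \<open>k\<close>-th row of \<open>G\<^sub>i\<^sup>T (\<partial>\<phi>\<^sub>i\<^sup>(\<^sup>r\<^sup>)/\<partial>x)\<^sup>T\<close>.\<close>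

definition Phi_bar :: "'n::finite game \<Rightarrow> 'n basis_data \<Rightarrow> nat \<Rightarrow> real ^ 'n \<Rightarrow> real mat" where
  "Phi_bar g b i x = Matrix.mat (cdim g i) (cdim g i * hrel b i)
     (\<lambda>(k, c). if c div hrel b i = k
        then input_grad g i (\<lambda>y. phi b i y $ (c mod hrel b i)) x $ k else 0)"

section \<open>Demonstrations and identification of the equilibrium strategies\<close>

text \<open>
  \<open>xdem e d\<close> is the state trajectory of demonstration \<open>d\<close>, and \<open>udem e i d\<close> the control of
  player \<open>i\<close> along it.
\<close>

record 'n demos =
  ndemo :: nat
  nsamp :: nat
  tstep :: real
  xdem :: "nat \<Rightarrow> real \<Rightarrow> real ^ 'n"
  udem :: "nat \<Rightarrow> nat \<Rightarrow> real \<Rightarrow> real vec"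

definition valid_demos :: "'n::finite game \<Rightarrow> 'n strategies \<Rightarrow> 'n demos \<Rightarrow> bool" where
  "valid_demos g \<mu> e \<longleftrightarrow> 1 \<le> ndemo e \<and> 1 \<le> nsamp e \<and> 0 < tstep e \<and>
     (\<forall>d<ndemo e. trajectory g \<mu> (xdem e d) \<and>
        (\<forall>i<nplayers g. \<forall>t\<ge>t_init g. udem e i d t = \<mu> i (xdem e d t)))"

definition samples :: "'n::finite game \<Rightarrow> 'n demos \<Rightarrow> (nat \<times> real) list" where
  "samples g e = List.product [0..<ndemo e]
     (map (\<lambda>k. t_init g + real k * tstep e) [0..<nsamp e])"

definition M_u :: "'n::finite game \<Rightarrow> 'n basis_data \<Rightarrow> 'n demos \<Rightarrow> nat \<Rightarrow> real mat" where
  "M_u g b e i = mat_of_rows (cdim g i * hrel b i)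
     (concat (map (\<lambda>(d, t). Matrix.rows ((- 1 / 2) \<cdot>\<^sub>m Phi_bar g b i (xdem e d t))) (samples g e)))"

definition z_u :: "'n::finite game \<Rightarrow> 'n demos \<Rightarrow> nat \<Rightarrow> real vec" where
  "z_u g e i = stack_vecs (map (\<lambda>(d, t). udem e i d t) (samples g e))"

definition theta_bar_hat :: "'n::finite game \<Rightarrow> 'n basis_data \<Rightarrow> 'n demos \<Rightarrow> nat \<Rightarrow> real vec" where
  "theta_bar_hat g b e i = (let M = M_u g b e i in
     mp_inverse (transpose_mat M * M) *\<^sub>v (transpose_mat M *\<^sub>v z_u g e i))"

definition mu_hat :: "'n::finite game \<Rightarrow> 'n basis_data \<Rightarrow> 'n demos \<Rightarrow> 'n strategies" where
  "mu_hat g b e i x = (- 1 / 2) \<cdot>\<^sub>v (Phi_bar g b i x *\<^sub>v theta_bar_hat g b e i)"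

section \<open>Data of the HJB-based identification\<close>

definition HJB_row :: "'n::finite game \<Rightarrow> 'n basis_data \<Rightarrow> 'n strategies \<Rightarrow> nat \<Rightarrow> real ^ 'n \<Rightarrow> real vec" where
  "HJB_row g b \<mu> i x =
     hadamard (stacked_ctrl g \<mu> x) (stacked_ctrl g \<mu> x) @\<^sub>v psi b i x
       @\<^sub>v phi_dir b i x (closed_loop g \<mu> x)"

definition M_HJB ::
  "'n::finite game \<Rightarrow> 'n basis_data \<Rightarrow> 'n demos \<Rightarrow> (real ^ 'n) list \<Rightarrow> nat \<Rightarrow> real mat" where
  "M_HJB g b e xs i = mat_of_rows (cdim_total g + mdim b i + hdim b i)
     (map (HJB_row g b (mu_hat g b e) i) xs)"

definition HJB_solution ::
  "'n::finite game \<Rightarrow> 'n basis_data \<Rightarrow> 'n demos \<Rightarrow> (real ^ 'n) list \<Rightarrow> nat \<Rightarrow> real vec \<Rightarrow> real vec" where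
  "HJB_solution g b e xs i w = (let
       q = cdim_total g + mdim b i; n = q + hdim b i;
       M = M_HJB g b e xs i; Mbar = transpose_mat M * M;
       z = 0\<^sub>v (length xs);
       L = Matrix.mat q n (\<lambda>(r, c). if r = c then 1 else 0)
     in (L * mp_inverse Mbar * transpose_mat M) *\<^sub>v z
        + (L * (1\<^sub>m n - mp_inverse Mbar * Mbar)) *\<^sub>v w)"

section \<open>Hypotheses on the observed game\<close>

text \<open>
  Here \<open>\<mu>\<close> is the equilibrium and \<open>\<theta> i\<close> the coefficient vector of the value function of
  player \<open>i\<close>. The ranks are maximal among all admissible choices of the data.
\<close>

definition identification_hypotheses ::
  "'n::finite game \<Rightarrow> 'n strategies \<Rightarrow> 'n basis_data \<Rightarrow> (nat \<Rightarrow> real vec) \<Rightarrow> 'n demos \<Rightarrow> (real ^ 'n) list \<Rightarrow> bool"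
where
  "identification_hypotheses g \<mu> b \<theta> e xs \<longleftrightarrow>
     differential_game g \<and> compact (region g) \<and> is_FNE g \<mu> \<and>
     (\<forall>i<nplayers g. \<forall>j<nplayers g. diagonal_mat (ctrl_cost g i j)) \<and>
     (\<forall>i<nplayers g.
        (\<forall>x. phi b i x \<in> carrier_vec (hdim b i)) \<and>
        (\<forall>j<hdim b i. C2_on (region g) (\<lambda>x. phi b i x $ j)) \<and>
        split_basis g b i \<and>
        \<theta> i \<in> carrier_vec (hdim b i) \<and>
        value_function g \<mu> i (\<lambda>x. scalar_prod (\<theta> i) (phi b i x))) \<and>
     valid_demos g \<mu> e \<and>
     (\<forall>i<nplayers g.
        (\<forall>e'. valid_demos g \<mu> e' \<longrightarrow> mat_rank (M_u g b e' i) \<le> mat_rank (M_u g b e i)) \<and>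
        mat_rank (M_u g b e i) < cdim g i * hrel b i) \<and>
     xs \<noteq> [] \<and> set xs \<subseteq> region g \<and>
     (\<forall>i<nplayers g. \<forall>ys. set ys \<subseteq> region g \<longrightarrow>
        mat_rank (M_HJB g b e ys i) \<le> mat_rank (M_HJB g b e xs i)) \<and>
     (\<forall>i<nplayers g. \<forall>x. psi b i x \<in> carrier_vec (mdim b i)) \<and>
     (\<forall>i<nplayers g. \<not> (\<exists>c\<in>carrier_vec (mdim b i). \<forall>x\<in>region g.
        state_cost g i x = scalar_prod c (psi b i x))) \<and>
     (\<exists>A. SW_subalgebra (region g) A \<and>
        (\<forall>i<nplayers g. \<forall>l<mdim b i. (\<lambda>x. psi b i x $ l) \<in> A))"

text \<open>
  The approximation error \<open>\<epsilon>\<close> of the state cost of player \<open>i\<close> for the parameter \<open>\<beta>\<close>, together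
  with the perturbed HJB equation it causes.
\<close>

definition residual_representation ::
  "'n::finite game \<Rightarrow> 'n strategies \<Rightarrow> 'n basis_data \<Rightarrow> nat \<Rightarrow> real vec \<Rightarrow> real vec \<Rightarrow> (real ^ 'n \<Rightarrow> real) \<Rightarrow> bool"
where
  "residual_representation g \<mu> b i \<beta> \<theta> \<epsilon> \<longleftrightarrow>
     bounded (\<epsilon> ` region g) \<and> C1_on (region g) \<epsilon> \<and>
     (\<forall>x\<in>region g. state_cost g i x = scalar_prod \<beta> (psi b i x) + \<epsilon> x) \<and>
     (\<forall>x\<in>region g. scalar_prod (HJB_row g b \<mu> i x) (weight_diag g i @\<^sub>v \<beta> @\<^sub>v \<theta>) = - \<epsilon> x)"

end

theory Submission
  imports Defs
begin

text \<open>
  The residual is \<open>\<epsilon>\<^sub>i = Q\<^sub>i - \<beta>\<^sub>i\<^sup>T \<psi>\<^sub>i\<close>, and the perturbed equation is the Hamilton--Jacobi--Bellman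
  equation of the equilibrium with \<open>Q\<^sub>i\<close> replaced.

  The counterexample has one player with a scalar control on the closed unit ball of any dimension.
  Writing \<open>s\<close> for the squared norm of \<open>x\<close>, the dynamics are \<open>x' = (s - 1) x + u x\<close> and the control
  weight is \<open>1\<close>. For \<open>k \<ge> 1\<close> the state cost \<open>2 k s + (k\<^sup>2 - 2 k) s\<^sup>2\<close> has the value function \<open>k s\<close> and
  the unique equilibrium \<open>u = - k s\<close>. For \<open>k = 1\<close> the state cost \<open>2 s - s\<^sup>2\<close> is no multiple of
  \<open>\<psi> = s\<close>, while for \<open>k = 2\<close> it is \<open>4 s\<close>. Along the equilibrium for \<open>k = 1\<close> the closed loop is \<open>x' = - x\<close>
  and the function \<open>2 s + s\<^sup>2 / 4\<close> in the span of \<open>\<phi> = (s, s\<^sup>2, s + 1)\<close> has the derivative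
  \<open>- 4 s - s\<^sup>2\<close>; hence weight \<open>1\<close> and state cost \<open>4 s\<close> solve the homogeneous identification equation,
  although their equilibrium is \<open>- 2 s\<close> and not \<open>- s\<close>.
\<close>

section \<open>Smooth functions\<close>

lemma C1_onE:
  assumes "C1_on X f"
  obtains U f' where "open U" "X \<subseteq> U" "continuous_on U f'"
    "\<And>x. x \<in> U \<Longrightarrow> (f has_derivative blinfun_apply (f' x)) (at x)"
  using assms unfolding C1_on_def by blast

lemma C1_onI:
  assumes "open U" "X \<subseteq> U" "continuous_on U f'"
    "\<And>x. x \<in> U \<Longrightarrow> (f has_derivative blinfun_apply (f' x)) (at x)"
  shows "C1_on X f"
  using assms unfolding C1_on_def by blast

lemma C1_on_subset: "C1_on X f \<Longrightarrow> Y \<subseteq> X \<Longrightarrow> C1_on Y f"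
  unfolding C1_on_def by blast

lemma C1_on_imp_differentiable: "C1_on X f \<Longrightarrow> x \<in> X \<Longrightarrow> f differentiable (at x)"
  unfolding C1_on_def differentiable_def by blast

lemma C1_on_imp_continuous_on: "C1_on X f \<Longrightarrow> continuous_on X f"
  by (meson C1_on_imp_differentiable continuous_at_imp_continuous_on differentiable_imp_continuous_within)

lemma C1_on_const: "C1_on X (\<lambda>x. c)"
  by (rule C1_onI[of UNIV _ "\<lambda>x. 0"]) (auto simp: zero_blinfun.rep_eq)

lemma C1_on_bounded_linear: "bounded_linear f \<Longrightarrow> C1_on X f"
  by (rule C1_onI[of UNIV _ "\<lambda>x. Blinfun f"])
    (auto simp: bounded_linear_Blinfun_apply intro: bounded_linear_imp_has_derivative)

lemma C1_on_add:
  assumes "C1_on X f" "C1_on X g"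
  shows "C1_on X (\<lambda>x. f x + g x)"
proof -
  obtain U f' where f: "open U" "X \<subseteq> U" "continuous_on U f'"
    "\<And>x. x \<in> U \<Longrightarrow> (f has_derivative blinfun_apply (f' x)) (at x)"
    using C1_onE[OF assms(1)] by blast
  obtain V g' where g: "open V" "X \<subseteq> V" "continuous_on V g'"
    "\<And>x. x \<in> V \<Longrightarrow> (g has_derivative blinfun_apply (g' x)) (at x)"
    using C1_onE[OF assms(2)] by blast
  show ?thesis
  proof (rule C1_onI[of "U \<inter> V" _ "\<lambda>x. f' x + g' x"])
    show "continuous_on (U \<inter> V) (\<lambda>x. f' x + g' x)"
      by (intro continuous_intros continuous_on_subset[OF f(3)] continuous_on_subset[OF g(3)]) auto
    fix x assume "x \<in> U \<inter> V"
    then show "((\<lambda>x. f x + g x) has_derivative blinfun_apply (f' x + g' x)) (at x)"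
      using has_derivative_add[OF f(4) g(4)] by (simp add: plus_blinfun.rep_eq)
  qed (use f g in auto)
qed

text \<open>One product rule for a real and a vector-valued factor serves real products, the drift
  of the radial game and the operator-valued derivatives in \<open>C2_on_mult\<close>.\<close>

lemma C1_on_scaleR:
  fixes r :: "'a::real_normed_vector \<Rightarrow> real"
  assumes "C1_on X r" "C1_on X g"
  shows "C1_on X (\<lambda>x. r x *\<^sub>R g x)"
proof -
  obtain U r' where r: "open U" "X \<subseteq> U" "continuous_on U r'"
    "\<And>x. x \<in> U \<Longrightarrow> (r has_derivative blinfun_apply (r' x)) (at x)"
    using C1_onE[OF assms(1)] by blast
  obtain V g' where g: "open V" "X \<subseteq> V" "continuous_on V g'"
    "\<And>x. x \<in> V \<Longrightarrow> (g has_derivative blinfun_apply (g' x)) (at x)"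
    using C1_onE[OF assms(2)] by blast
  \<comment> \<open>The product rule as a bounded operator: the second summand sends a direction
    \<open>h\<close> to \<open>r' x h *\<^sub>R g x\<close>.\<close>
  let ?D = "\<lambda>x. r x *\<^sub>R g' x + (blinfun_scaleR_left (g x) o\<^sub>L r' x)"
  have rc: "continuous_on U r" and gc: "continuous_on V g"
    by (auto intro!: continuous_at_imp_continuous_on has_derivative_continuous r(4) g(4))
  show ?thesis
  proof (rule C1_onI[of "U \<inter> V" _ ?D])
    show "continuous_on (U \<inter> V) ?D"
      by (intro continuous_intros bounded_linear.continuous_on[OF bounded_linear_blinfun_scaleR_left]
            bounded_bilinear.continuous_on[OF bounded_bilinear_blinfun_compose]
            continuous_on_subset[OF r(3)] continuous_on_subset[OF g(3)]
            continuous_on_subset[OF rc] continuous_on_subset[OF gc]) auto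
    fix x assume x: "x \<in> U \<inter> V"
    show "((\<lambda>x. r x *\<^sub>R g x) has_derivative blinfun_apply (?D x)) (at x)"
      by (rule has_derivative_eq_rhs[OF has_derivative_scaleR[OF r(4) g(4)]])
        (use x in \<open>auto simp: blinfun.bilinear_simps\<close>)
  qed (use r g in auto)
qed

lemma C1_on_mult:
  fixes f g :: "'a::real_normed_vector \<Rightarrow> real"
  shows "C1_on X f \<Longrightarrow> C1_on X g \<Longrightarrow> C1_on X (\<lambda>x. f x * g x)"
  using C1_on_scaleR[of X f g] by simp

lemma C1_on_diff:
  fixes f g :: "'a::real_normed_vector \<Rightarrow> real"
  shows "C1_on X f \<Longrightarrow> C1_on X g \<Longrightarrow> C1_on X (\<lambda>x. f x - g x)"
  using C1_on_add[OF _ C1_on_scaleR[OF C1_on_const[of X "-1"]], of f g] by simp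

lemma C1_on_sum:
  "(\<And>i. i \<in> I \<Longrightarrow> C1_on X (f i)) \<Longrightarrow> C1_on X (\<lambda>x. \<Sum>i\<in>I. f i x)"
  by (induction I rule: infinite_finite_induct) (auto intro: C1_on_const C1_on_add)

lemma C2_on_imp_C1_on:
  assumes "C2_on X f"
  shows "C1_on X f"
proof -
  obtain U f' where "open U" "X \<subseteq> U" "C1_on U f'"
    "\<And>x. x \<in> U \<Longrightarrow> (f has_derivative blinfun_apply (f' x)) (at x)"
    using assms unfolding C2_on_def by blast
  then show ?thesis by (intro C1_onI[of U X f' f]) (auto intro: C1_on_imp_continuous_on)
qed

lemma C2_on_const: "C2_on X (\<lambda>x. c)"
  unfolding C2_on_def
  by (rule exI[of _ UNIV], rule exI[of _ "\<lambda>x. 0"]) (auto simp: zero_blinfun.rep_eq intro: C1_on_const)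

lemma C2_on_inner_self: "C2_on X (\<lambda>x. inner x x)"
proof -
  \<comment> \<open>The derivative of the squared norm depends linearly on the base point, so the
    derivative map is itself bounded linear.\<close>
  have "C1_on UNIV (\<lambda>x::'a. 2 *\<^sub>R blinfun_inner_right x)"
    by (intro C1_on_bounded_linear bounded_linear_const_scaleR bounded_linear_blinfun_inner_right)
  moreover have "((\<lambda>x. inner x x) has_derivative blinfun_apply (2 *\<^sub>R blinfun_inner_right x)) (at x)" for x :: 'a
    by (rule has_derivative_eq_rhs[OF has_derivative_inner[OF has_derivative_ident has_derivative_ident]])
      (auto simp: blinfun.bilinear_simps inner_commute)
  ultimately show ?thesis
    unfolding C2_on_def by (intro exI[of _ UNIV] exI[of _ "\<lambda>x. 2 *\<^sub>R blinfun_inner_right x"]) auto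
qed

lemma C2_on_add:
  assumes "C2_on X f" "C2_on X g"
  shows "C2_on X (\<lambda>x. f x + g x)"
proof -
  obtain U f' where f: "open U" "X \<subseteq> U" "C1_on U f'"
    "\<And>x. x \<in> U \<Longrightarrow> (f has_derivative blinfun_apply (f' x)) (at x)"
    using assms(1) unfolding C2_on_def by blast
  obtain V g' where g: "open V" "X \<subseteq> V" "C1_on V g'"
    "\<And>x. x \<in> V \<Longrightarrow> (g has_derivative blinfun_apply (g' x)) (at x)"
    using assms(2) unfolding C2_on_def by blast
  have "C1_on (U \<inter> V) (\<lambda>x. f' x + g' x)"
    by (intro C1_on_add C1_on_subset[OF f(3)] C1_on_subset[OF g(3)]) auto
  moreover have "((\<lambda>x. f x + g x) has_derivative blinfun_apply (f' x + g' x)) (at x)"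
    if "x \<in> U \<inter> V" for x
    using that has_derivative_add[OF f(4) g(4)] by (simp add: plus_blinfun.rep_eq)
  ultimately show ?thesis
    unfolding C2_on_def using f(1,2) g(1,2)
    by (intro exI[of _ "U \<inter> V"] exI[of _ "\<lambda>x. f' x + g' x"]) auto
qed

lemma C2_on_mult:
  fixes f g :: "'a::real_normed_vector \<Rightarrow> real"
  assumes "C2_on X f" "C2_on X g"
  shows "C2_on X (\<lambda>x. f x * g x)"
proof -
  obtain U f' where f: "open U" "X \<subseteq> U" "C1_on U f'"
    "\<And>x. x \<in> U \<Longrightarrow> (f has_derivative blinfun_apply (f' x)) (at x)"
    using assms(1) unfolding C2_on_def by blast
  obtain V g' where g: "open V" "X \<subseteq> V" "C1_on V g'"
    "\<And>x. x \<in> V \<Longrightarrow> (g has_derivative blinfun_apply (g' x)) (at x)"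
    using assms(2) unfolding C2_on_def by blast
  have "C1_on U f" "C1_on V g"
    by (rule C1_onI[OF f(1) subset_refl C1_on_imp_continuous_on[OF f(3)] f(4)],
        assumption)
      (rule C1_onI[OF g(1) subset_refl C1_on_imp_continuous_on[OF g(3)] g(4)])
  then have "C1_on (U \<inter> V) (\<lambda>x. f x *\<^sub>R g' x + g x *\<^sub>R f' x)"
    using f(3) g(3) by (intro C1_on_add C1_on_scaleR) (auto intro: C1_on_subset)
  moreover have "((\<lambda>x. f x * g x) has_derivative blinfun_apply (f x *\<^sub>R g' x + g x *\<^sub>R f' x)) (at x)"
    if "x \<in> U \<inter> V" for x
    by (rule has_derivative_eq_rhs[OF has_derivative_mult[OF f(4) g(4)]])
      (use that in \<open>auto simp: blinfun.bilinear_simps algebra_simps\<close>)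
  ultimately show ?thesis
    unfolding C2_on_def using f(1,2) g(1,2)
    by (intro exI[of _ "U \<inter> V"] exI[of _ "\<lambda>x. f x *\<^sub>R g' x + g x *\<^sub>R f' x"]) auto
qed

text \<open>In the open ball, equality of the functions gives equality of the derivatives. Both
  derivatives are continuous up to the sphere, so they agree there too, although the functions may
  differ outside. This is needed because a value function is determined on the region only.\<close>

lemma C1_on_frechet_derivative_cong:
  fixes f g :: "'a::euclidean_space \<Rightarrow> real"
  assumes "C1_on (cball 0 1) f" "C1_on (cball 0 1) g"
    and eq: "\<And>x. x \<in> cball 0 1 \<Longrightarrow> f x = g x" and x: "x \<in> cball 0 1"
  shows "frechet_derivative f (at x) = frechet_derivative g (at x)"
proof -
  obtain U f' where f: "open U" "cball 0 1 \<subseteq> U" "continuous_on U f'"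
    "\<And>x. x \<in> U \<Longrightarrow> (f has_derivative blinfun_apply (f' x)) (at x)"
    using C1_onE[OF assms(1)] by blast
  obtain V g' where g: "open V" "cball 0 1 \<subseteq> V" "continuous_on V g'"
    "\<And>x. x \<in> V \<Longrightarrow> (g has_derivative blinfun_apply (g' x)) (at x)"
    using C1_onE[OF assms(2)] by blast
  have zero: "f' y - g' y = 0" if y: "y \<in> ball 0 1" for y
  proof -
    have yU: "y \<in> U" and yV: "y \<in> V" using y f(2) g(2) by auto
    have "(g has_derivative blinfun_apply (f' y)) (at y)"
      by (rule has_derivative_transform_within_open[OF f(4)[OF yU] open_ball y]) (simp add: eq)
    from has_derivative_unique[OF this g(4)[OF yV]]
    have "blinfun_apply (f' y) = blinfun_apply (g' y)" .
    then show ?thesis by (simp add: blinfun_apply_inject)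
  qed
  have cont: "continuous_on (closure (ball 0 1)) (\<lambda>x. f' x - g' x)"
    by (intro continuous_on_diff continuous_on_subset[OF f(3)] continuous_on_subset[OF g(3)])
      (use f(2) g(2) in auto)
  have "f' x - g' x = 0"
    by (rule continuous_constant_on_closure[OF cont zero]) (use x in simp_all)
  moreover have "frechet_derivative f (at x) = blinfun_apply (f' x)"
    using frechet_derivative_at[OF f(4)] f(2) x by (metis subsetD)
  moreover have "frechet_derivative g (at x) = blinfun_apply (g' x)"
    using frechet_derivative_at[OF g(4)] g(2) x by (metis subsetD)
  ultimately show ?thesis by simp
qed

section \<open>Scalar control of a radial system\<close>

text \<open>Drift and input column are both multiples of \<open>x\<close>. The dynamics and the
  Hamilton--Jacobi--Bellman equation therefore involve the derivative of a value function only in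
  the direction \<open>x\<close>.\<close>

definition radial_game :: "(real ^ 'n \<Rightarrow> real) \<Rightarrow> 'n::finite game" where
  "radial_game Q = \<lparr>nplayers = 1, t_init = 0, region = cball 0 1, cdim = (\<lambda>_. 1),
     drift = (\<lambda>x. (inner x x - 1) *\<^sub>R x), in_col = (\<lambda>_ x _. x),
     state_cost = (\<lambda>_. Q), ctrl_cost = (\<lambda>_ _. 1\<^sub>m 1)\<rparr>"

lemma radial_game_simps [simp]:
  "nplayers (radial_game Q) = 1" "t_init (radial_game Q) = 0"
  "region (radial_game Q) = cball 0 1" "cdim (radial_game Q) i = 1"
  "drift (radial_game Q) x = (inner x x - 1) *\<^sub>R x" "in_col (radial_game Q) i x k = x"
  "state_cost (radial_game Q) i = Q" "ctrl_cost (radial_game Q) i j = 1\<^sub>m 1"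
  by (simp_all add: radial_game_def)

lemma closed_loop_radial:
  "closed_loop (radial_game Q) \<mu> x = (inner x x - 1 + \<mu> 0 x $ 0) *\<^sub>R x"
  by (simp add: closed_loop_def input_def scaleR_add_left)

lemma ctrl_penalty_radial:
  assumes "\<mu> 0 x \<in> carrier_vec 1"
  shows "ctrl_penalty (radial_game Q) \<mu> i x = (\<mu> 0 x $ 0)\<^sup>2"
  using assms by (simp add: ctrl_penalty_def scalar_prod_def power2_eq_square)

lemma trajectory_radial:
  "trajectory (radial_game Q) \<mu> x \<longleftrightarrow> (\<forall>t\<ge>0. x t \<in> cball 0 1 \<and>
     (x has_vector_derivative (inner (x t) (x t) - 1 + \<mu> 0 (x t) $ 0) *\<^sub>R x t) (at t within {0..}))"
  by (simp add: trajectory_def closed_loop_radial)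

text \<open>The identity is a unit of the matrix ring, which excludes \<open>None\<close>; whatever
  inverse is returned must then be the identity.\<close>

lemma mat_inverse_one: "mat_inverse (1\<^sub>m n :: real mat) = Some (1\<^sub>m n)"
proof (cases "mat_inverse (1\<^sub>m n :: real mat)")
  case None
  then have "(1\<^sub>m n :: real mat) \<notin> Units (ring_mat TYPE(real) n undefined)"
    by (rule mat_inverse(1)[OF one_carrier_mat])
  moreover have "(1\<^sub>m n :: real mat) \<in> Units (ring_mat TYPE(real) n undefined)"
    unfolding Units_def ring_mat_def by (auto intro!: bexI[of _ "1\<^sub>m n"])
  ultimately show ?thesis by blast
next
  case (Some B)
  from mat_inverse(2)[OF one_carrier_mat this] Some show ?thesis by auto
qed

text \<open>With a single control component and weight 1, the vector equation for the strategy
  reduces to its component 0.\<close>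

lemma coupled_HJB_radial:
  assumes "\<And>x. \<mu> 0 x \<in> carrier_vec 1"
  shows "coupled_HJB (radial_game Q) \<mu> V \<longleftrightarrow> (\<forall>x\<in>cball 0 1.
     0 = frechet_derivative (V 0) (at x) ((inner x x - 1 + \<mu> 0 x $ 0) *\<^sub>R x)
       + (\<mu> 0 x $ 0)\<^sup>2 + Q x \<and>
     \<mu> 0 x $ 0 = - frechet_derivative (V 0) (at x) x / 2)"
proof -
  have "\<mu> 0 x = (- 1 / 2) \<cdot>\<^sub>v (1\<^sub>m 1 *\<^sub>v Matrix.vec 1 (\<lambda>k. frechet_derivative (V 0) (at x) x))
      \<longleftrightarrow> \<mu> 0 x $ 0 = - frechet_derivative (V 0) (at x) x / 2" for x
    using assms[of x] by (auto simp: vec_eq_iff)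
  then show ?thesis
    unfolding coupled_HJB_def
    by (simp add: closed_loop_radial ctrl_penalty_radial[of \<mu>, OF assms] mat_inverse_one input_grad_def)
qed

lemma admissible_radial:
  assumes "admissible (radial_game Q) \<mu>"
  shows "\<mu> 0 x \<in> carrier_vec 1" "\<mu> 0 0 = 0\<^sub>v 1" "continuous_on (cball 0 1) (\<lambda>x. \<mu> 0 x $ 0)"
    "stabilizing (radial_game Q) \<mu>" "\<exists>V. value_function (radial_game Q) \<mu> 0 V"
  using assms by (auto simp: admissible_def intro: C1_on_imp_continuous_on)

text \<open>Player 0 is the only player, so a tuple may be exchanged for any other with the same
  entry 0. This identifies a deviation \<open>\<mu>(0 := radial_strategy k 0)\<close> with
  \<open>radial_strategy k\<close>.\<close>

lemma strategy_cong_radial: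
  assumes "\<mu> 0 = \<nu> 0"
  shows "admissible (radial_game Q) \<mu> = admissible (radial_game Q) \<nu>"
    "value_function (radial_game Q) \<mu> = value_function (radial_game Q) \<nu>"
proof -
  have tr: "trajectory (radial_game Q) \<mu> = trajectory (radial_game Q) \<nu>"
    using assms by (simp add: fun_eq_iff trajectory_radial)
  have pen: "ctrl_penalty (radial_game Q) \<mu> = ctrl_penalty (radial_game Q) \<nu>"
    using assms by (simp add: fun_eq_iff ctrl_penalty_def)
  show v: "value_function (radial_game Q) \<mu> = value_function (radial_game Q) \<nu>"
    by (simp add: fun_eq_iff value_function_def tr pen)
  show "admissible (radial_game Q) \<mu> = admissible (radial_game Q) \<nu>"
    using assms by (simp add: admissible_def stabilizing_def tr v)
qed

section \<open>Value functions as costs along trajectories\<close>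

lemma value_function_integral:
  assumes "value_function g \<mu> i V" "trajectory g \<mu> x" "t_init g \<le> t"
  shows "((\<lambda>\<tau>. state_cost g i (x \<tau>) + ctrl_penalty g \<mu> i (x \<tau>)) has_integral V (x t)) {t..}"
  using assms by (simp add: value_function_def)

lemma stabilizing_trajectory:
  assumes "stabilizing g \<mu>" "x0 \<in> region g"
  obtains x where "trajectory g \<mu> x" "x (t_init g) = x0"
  using assms unfolding stabilizing_def by blast

text \<open>Admissibility provides a trajectory from every point of the region, and along it both
  values are the same integral.\<close>

lemma value_function_unique:
  assumes "admissible g \<mu>" "value_function g \<mu> i V" "value_function g \<mu> i W" "x \<in> region g"
  shows "V x = W x"
proof -
  obtain y where y: "trajectory g \<mu> y" "y (t_init g) = x"
    using stabilizing_trajectory[of g \<mu> x] assms(1,4) unfolding admissible_def by blast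
  show ?thesis
    using has_integral_unique[OF value_function_integral[OF assms(2) y(1) order_refl]
        value_function_integral[OF assms(3) y(1) order_refl]] y(2) by simp
qed

lemma value_function_continuous:
  "value_function g \<mu> i V \<Longrightarrow> x \<in> region g \<Longrightarrow> isCont V x"
  by (meson C1_on_imp_differentiable C2_on_imp_C1_on differentiable_imp_continuous_within value_function_def)

text \<open>The origin is a rest point under every strategy, and the running cost vanishes
  there.\<close>

lemma value_function_radial_zero:
  assumes "admissible (radial_game Q) \<mu>" "value_function (radial_game Q) \<mu> 0 V" "Q 0 = 0"
  shows "V 0 = 0"
proof -
  have "trajectory (radial_game Q) \<mu> (\<lambda>t. 0)"
    by (auto simp: trajectory_radial)
  then have "((\<lambda>\<tau>::real. Q 0 + ctrl_penalty (radial_game Q) \<mu> 0 0) has_integral V 0) {0..}"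
    using value_function_integral[OF assms(2), of "\<lambda>t. 0" 0] by simp
  moreover have "ctrl_penalty (radial_game Q) \<mu> 0 0 = 0"
    using admissible_radial(1,2)[OF assms(1)] by (simp add: ctrl_penalty_radial)
  ultimately show ?thesis
    using has_integral_unique[of "\<lambda>\<tau>::real. 0" "V 0" "{0..}" 0] assms(3) by simp
qed

lemma trajectory_continuous_on:
  assumes "trajectory g \<mu> x"
  shows "continuous_on {t_init g..} x"
  using assms unfolding trajectory_def continuous_on_eq_continuous_within
  by (auto intro: has_vector_derivative_continuous)

text \<open>Completing the square along a trajectory of an arbitrary strategy.\<close>

lemma radial_verification:
  fixes Q :: "real ^ 'n::finite \<Rightarrow> real"
  assumes V: "\<And>x. x \<in> cball 0 1 \<Longrightarrow> V differentiable (at x)" "V 0 = 0"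
    and u: "continuous_on (cball 0 1) u" and Q: "continuous_on (cball 0 1) Q" "Q 0 = 0"
    and HJB: "\<And>x. x \<in> cball 0 1 \<Longrightarrow>
        0 = (inner x x - 1 + u x) * frechet_derivative V (at x) x + (u x)\<^sup>2 + Q x"
      "\<And>x. x \<in> cball 0 1 \<Longrightarrow> u x = - frechet_derivative V (at x) x / 2"
    and \<nu>: "admissible (radial_game Q) \<nu>" "value_function (radial_game Q) \<nu> 0 W"
    and x0: "x0 \<in> cball 0 1"
  shows "V x0 \<le> W x0" and "V x0 = W x0 \<Longrightarrow> \<nu> 0 x0 $ 0 = u x0"
proof -
  obtain x where x: "trajectory (radial_game Q) \<nu> x" "x 0 = x0"
    using stabilizing_trajectory[OF admissible_radial(4)[OF \<nu>(1)], of x0] x0 by auto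
  have xX: "x t \<in> cball 0 1" if "t \<ge> 0" for t
    using x(1) that by (auto simp: trajectory_radial)
  define y where "y t = \<nu> 0 (x t) $ 0" for t
  define l where "l t = Q (x t) + (y t)\<^sup>2" for t
  define e where "e t = (y t - u (x t))\<^sup>2" for t
  define F where "F t = V (x t) - W (x t)" for t
  have xc: "continuous_on {0..} x" using trajectory_continuous_on[OF x(1)] by simp
  have comp: "continuous_on {0..} (\<lambda>t. h (x t))" if "continuous_on (cball 0 1) h" for h :: "real ^ 'n \<Rightarrow> real"
    by (rule continuous_on_compose2[OF that xc]) (use xX in auto)
  have yc: "continuous_on {0..} y"
    unfolding y_def by (rule comp[OF admissible_radial(3)[OF \<nu>(1)]])
  have lc: "continuous_on {0..} l" and ec: "continuous_on {0..} e"
    unfolding l_def e_def by (intro continuous_intros comp yc Q u)+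
  \<comment> \<open>\<open>W (x T)\<close> is the cost on \<open>{T..}\<close>, so cutting the
    half-line at \<open>T\<close> leaves the cost of the initial segment.\<close>
  have l_int: "(l has_integral (W (x 0) - W (x T))) {0..T}" if T: "T \<ge> 0" for T
  proof -
    have pen: "ctrl_penalty (radial_game Q) \<nu> 0 (x \<tau>) = (y \<tau>)\<^sup>2" for \<tau>
      unfolding y_def using ctrl_penalty_radial[of \<nu> "x \<tau>" Q 0] admissible_radial(1)[OF \<nu>(1)] by simp
    have W: "(l has_integral W (x t)) {t..}" if "t \<ge> 0" for t
      using value_function_integral[OF \<nu>(2) x(1), of t] that unfolding l_def by (simp add: pen)
    have "l integrable_on {0..T}"
      by (intro integrable_continuous_interval continuous_on_subset[OF lc]) auto
    then have I: "(l has_integral (integral {0..T} l)) {0..T}" by (rule integrable_integral)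
    have "{0..T} \<inter> {T..} = {T}" "{0..T} \<union> {T..} = {0..}" using T by auto
    with has_integral_Un[OF I W[OF T]]
    have "(l has_integral (integral {0..T} l + W (x T))) {0..}" by simp
    from has_integral_unique[OF this W[of 0]] have "integral {0..T} l = W (x 0) - W (x T)" by simp
    then show ?thesis using I by simp
  qed
  \<comment> \<open>With \<open>D\<close> the derivative of \<open>V\<close> in direction
    \<open>x\<close>, the rate of \<open>V\<close> along the trajectory is
    \<open>(s - 1 + u) D + (y - u) D\<close>. The equation for \<open>V\<close> and
    \<open>D = - 2 u\<close> turn this into \<open>(y - u)\<^sup>2 - l\<close>.\<close>
  have V_int: "((\<lambda>t. e t - l t) has_integral (V (x T) - V (x 0))) {0..T}" if T: "T \<ge> 0" for T
  proof (rule fundamental_theorem_of_calculus[OF T])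
    fix t assume t: "t \<in> {0..T}"
    let ?D = "frechet_derivative V (at (x t))"
    have xt: "x t \<in> cball 0 1" using xX t by auto
    let ?c = "inner (x t) (x t) - 1 + y t"
    have dV: "(V has_derivative ?D) (at (x t))"
      using V(1)[OF xt] frechet_derivative_works by blast
    then interpret D: bounded_linear ?D by (rule has_derivative_bounded_linear)
    have "(x has_vector_derivative ?c *\<^sub>R x t) (at t within {0..})"
      using x(1) t unfolding trajectory_radial y_def by auto
    then have "(x has_derivative (\<lambda>h. h *\<^sub>R ?c *\<^sub>R x t)) (at t within {0..T})"
      unfolding has_vector_derivative_def by (rule has_derivative_subset) auto
    from has_derivative_compose[OF this dV]
    have "((\<lambda>t. V (x t)) has_vector_derivative ?c * ?D (x t)) (at t within {0..T})"
      unfolding has_vector_derivative_def by (simp add: D.scaleR mult.assoc)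
    moreover have "?c * ?D (x t) = e t - l t"
      using HJB(1)[OF xt] HJB(2)[OF xt] unfolding e_def l_def
      by (simp add: power2_eq_square algebra_simps)
    ultimately show "((\<lambda>t. V (x t)) has_vector_derivative e t - l t) (at t within {0..T})" by simp
  qed
  have e_int: "(e has_integral (F T - F 0)) {0..T}" if T: "T \<ge> 0" for T
    using has_integral_add[OF V_int[OF T] l_int[OF T]] by (simp add: F_def algebra_simps)
  \<comment> \<open>\<open>V - W\<close> grows at the nonnegative rate \<open>e\<close> and tends to
    0, since the trajectory converges to the origin, where both functions vanish. Hence it is never
    positive.\<close>
  have F_mono: "F S \<le> F T" if "0 \<le> S" "S \<le> T" for S T
  proof -
    have "F S - F 0 \<le> F T - F 0"
      by (rule has_integral_subset_le[OF _ e_int e_int]) (use that in \<open>auto simp: e_def\<close>)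
    then show ?thesis by simp
  qed
  have "(x \<longlongrightarrow> 0) at_top"
    using admissible_radial(4)[OF \<nu>(1)] x(1) unfolding stabilizing_def by blast
  moreover have "isCont (\<lambda>x. V x - W x) 0"
    using V(1)[of 0] value_function_continuous[OF \<nu>(2), of 0]
    by (intro continuous_intros) (auto intro: differentiable_imp_continuous_within)
  ultimately have "(F \<longlongrightarrow> V 0 - W 0) at_top"
    unfolding F_def by (rule isCont_tendsto_compose[rotated])
  then have Flim: "(F \<longlongrightarrow> 0) at_top"
    using V(2) value_function_radial_zero[OF \<nu> Q(2)] by simp
  have F_le: "F T \<le> 0" if "T \<ge> 0" for T
    by (rule tendsto_lowerbound[OF Flim])
      (use F_mono that in \<open>auto simp: eventually_at_top_linorder intro!: exI[of _ T]\<close>)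
  show "V x0 \<le> W x0" using F_le[of 0] x(2) by (simp add: F_def)
  assume "V x0 = W x0"
  then have "F 0 = 0" using x(2) by (simp add: F_def)
  \<comment> \<open>Equality at the start keeps \<open>F\<close> at 0 on the unit time interval, so
    the continuous nonnegative \<open>e\<close> has integral 0 there and vanishes at time 0.\<close>
  then have "F 1 = 0" using F_le[of 1] F_mono[of 0 1] by simp
  then have "(e has_integral 0) {0..1}" using e_int[of 1] \<open>F 0 = 0\<close> by simp
  then have "e 0 = 0"
    by (intro has_integral_0_cbox_imp_0[of 0 1 e])
      (auto simp: e_def[abs_def, symmetric] intro: continuous_on_subset[OF ec], auto simp: e_def)
  then show "\<nu> 0 x0 $ 0 = u x0" using x(2) by (simp add: e_def y_def)
qed

text \<open>
  Inserting the value function \<open>k s\<close>, with \<open>s\<close> the squared norm, into the Hamilton--Jacobi--Bellman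
  equation of the radial game yields this state cost.
\<close>

definition radial_cost :: "real \<Rightarrow> real ^ 'n::finite \<Rightarrow> real" where
  "radial_cost k x = 2 * k * inner x x + (k\<^sup>2 - 2 * k) * (inner x x)\<^sup>2"

definition radial_strategy :: "real \<Rightarrow> 'n::finite strategies" where
  "radial_strategy k i x = Matrix.vec 1 (\<lambda>_. - k * inner x x)"

lemma radial_strategy_simps [simp]:
  "radial_strategy k i x $ 0 = - k * inner x x" "radial_strategy k i x \<in> carrier_vec (Suc 0)"
  by (simp_all add: radial_strategy_def)

lemma inner_self_le_1: "x \<in> cball 0 1 \<Longrightarrow> inner x x \<le> 1"
  by (simp add: dot_square_norm power_le_one)

text \<open>The difference of the two sides is
  \<open>(k - 1)\<^sup>2 s\<^sup>2 + (k s - s\<^sup>2)\<close>, and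
  \<open>s \<le> 1 \<le> k\<close>. The lower bound \<open>k s\<close> instead of 0 also yields
  positivity away from the origin.\<close>

lemma radial_cost_nonneg:
  assumes "k \<ge> 1" "x \<in> cball 0 1"
  shows "k * inner x x \<le> radial_cost k x"
proof -
  let ?s = "inner x x"
  have s: "0 \<le> ?s" "?s \<le> 1" using inner_self_le_1[OF assms(2)] by auto
  have "(k - 1)\<^sup>2 * ?s\<^sup>2 \<ge> 0" by simp
  moreover have "?s\<^sup>2 \<le> ?s" using s by (simp add: power2_eq_square mult_left_le)
  moreover have "?s \<le> k * ?s" using mult_right_mono[OF assms(1) s(1)] by simp
  ultimately show ?thesis unfolding radial_cost_def by (simp add: power2_eq_square algebra_simps)
qed

lemma frechet_derivative_inner_self:
  "frechet_derivative (\<lambda>x. c * inner x x) (at x) h = c * (2 * inner x h)"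
proof -
  have "((\<lambda>x. c * inner x x) has_derivative (\<lambda>h. c * (2 * inner x h))) (at x)"
    by (auto intro!: derivative_eq_intros simp: inner_commute)
  from frechet_derivative_at[OF this] show ?thesis by metis
qed

section \<open>Closed-loop trajectories of the radial strategies\<close>

lemma trajectory_radial_strategy:
  "trajectory (radial_game Q) (radial_strategy k) x \<longleftrightarrow> (\<forall>t\<ge>0. x t \<in> cball 0 1 \<and>
     (x has_vector_derivative - (1 + (k - 1) * inner (x t) (x t)) *\<^sub>R x t) (at t within {0..}))"
proof -
  have "inner z z - 1 + radial_strategy k 0 z $ 0 = - (1 + (k - 1) * inner z z)" for z :: "real ^ 'a"
    by (simp add: algebra_simps)
  then show ?thesis unfolding trajectory_radial by (simp only:)
qed

text \<open>The squared norm solves the logistic equation \<open>s' = - 2 (1 + (k - 1) s) s\<close>.\<close>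

lemma radial_trajectory_exists:
  assumes k: "k \<ge> 1" and x0: "x0 \<in> cball 0 1"
  obtains x where "trajectory (radial_game Q) (radial_strategy k) x" "x 0 = x0"
proof -
  \<comment> \<open>The logistic solution is \<open>s t = s 0 / D t\<close>, hence the scaling of
    \<open>x0\<close> by \<open>1 / sqrt (D t)\<close>. As \<open>c\<close> is nonnegative,
    \<open>D t\<close> is at least 1 and the curve stays in the ball.\<close>
  define c where "c = (k - 1) * inner x0 x0"
  define D where "D t = (1 + c) * exp (2 * t) - c" for t
  define x where "x t = (1 / sqrt (D t)) *\<^sub>R x0" for t
  have c: "c \<ge> 0" using k by (simp add: c_def)
  have D: "D t \<ge> 1" if "t \<ge> 0" for t
  proof -
    have "(1 + c) * 1 \<le> (1 + c) * exp (2 * t)" using c that by (intro mult_left_mono) auto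
    then show ?thesis by (simp add: D_def)
  qed
  have "x t \<in> cball 0 1" if t: "t \<ge> 0" for t
  proof -
    have "sqrt (D t) \<ge> 1" using D[OF t] by simp
    moreover have "norm x0 \<le> 1" using x0 by simp
    ultimately have "norm x0 / sqrt (D t) \<le> 1" by (simp only: divide_le_eq_1) linarith
    then show ?thesis using \<open>sqrt (D t) \<ge> 1\<close> by (simp add: x_def)
  qed
  moreover have "(x has_vector_derivative - (1 + (k - 1) * inner (x t) (x t)) *\<^sub>R x t) (at t within {0..})"
    if t: "t \<ge> 0" for t
  proof -
    have Dp: "D t > 0" using D[OF t] by simp
    have dD: "(D has_real_derivative 2 * (D t + c)) (at t within {0..})"
      unfolding D_def by (auto intro!: derivative_eq_intros simp: algebra_simps)
    have "((\<lambda>t. 1 / sqrt (D t)) has_real_derivative - (1 + c / D t) / sqrt (D t)) (at t within {0..})"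
      using Dp by (auto intro!: derivative_eq_intros dD simp: field_simps)
    from has_vector_derivative_scaleR[OF this has_vector_derivative_const[of x0]]
    have "(x has_vector_derivative (- (1 + c / D t) / sqrt (D t)) *\<^sub>R x0) (at t within {0..})"
      unfolding x_def by simp
    moreover have "(k - 1) * inner (x t) (x t) = c / D t"
      using Dp by (simp add: x_def c_def)
    ultimately show ?thesis by (simp add: x_def)
  qed
  ultimately have "trajectory (radial_game Q) (radial_strategy k) x"
    unfolding trajectory_radial_strategy by blast
  moreover have "x 0 = x0" by (simp add: x_def D_def)
  ultimately show ?thesis using that by blast
qed

lemma radial_trajectory_inner_derivative:
  assumes "trajectory (radial_game Q) (radial_strategy k) x" "t \<ge> 0"
  shows "((\<lambda>t. inner (x t) (x t)) has_real_derivative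
     - 2 * (1 + (k - 1) * inner (x t) (x t)) * inner (x t) (x t)) (at t within {0..})"
proof -
  have d: "(x has_vector_derivative - (1 + (k - 1) * inner (x t) (x t)) *\<^sub>R x t) (at t within {0..})"
    using assms unfolding trajectory_radial_strategy by blast
  show ?thesis
    unfolding has_real_derivative_iff_has_vector_derivative
    by (rule has_vector_derivative_eq_rhs[OF bounded_bilinear.has_vector_derivative[OF bounded_bilinear_inner d d]])
      (simp add: inner_commute algebra_simps)
qed

text \<open>The product of \<open>s t\<close> and \<open>exp (2 * t)\<close> has the derivative
  \<open>?d\<close>, which is nonpositive for \<open>k \<ge> 1\<close>. The resulting bound gives
  both convergence to the origin and stability with \<open>d = e\<close>.\<close>

lemma radial_trajectory_decay:
  assumes k: "k \<ge> 1" and x: "trajectory (radial_game Q) (radial_strategy k) x" and t: "t \<ge> 0"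
  shows "norm (x t) \<le> exp (- t) * norm (x 0)"
proof -
  let ?s = "\<lambda>t. inner (x t) (x t)"
  let ?d = "\<lambda>t. - 2 * (k - 1) * (?s t)\<^sup>2 * exp (2 * t)"
  have "(?d has_integral (?s t * exp (2 * t) - ?s 0 * exp (2 * 0))) {0..t}"
  proof (rule fundamental_theorem_of_calculus[OF t])
    fix \<tau> assume "\<tau> \<in> {0..t}"
    then have "(?s has_real_derivative - 2 * (1 + (k - 1) * ?s \<tau>) * ?s \<tau>) (at \<tau> within {0..t})"
      using radial_trajectory_inner_derivative[OF x, of \<tau>] by (auto intro: DERIV_subset)
    then show "((\<lambda>t. ?s t * exp (2 * t)) has_vector_derivative ?d \<tau>) (at \<tau> within {0..t})"
      unfolding has_real_derivative_iff_has_vector_derivative[symmetric]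
      by (auto intro!: derivative_eq_intros simp: power2_eq_square algebra_simps)
  qed
  from has_integral_nonneg[OF has_integral_neg[OF this]]
  have "0 \<le> - (?s t * exp (2 * t) - ?s 0 * exp (2 * 0))"
    using k by (simp add: mult_nonpos_nonneg)
  then have "?s t * exp (2 * t) - ?s 0 \<le> 0" by simp
  then have "(norm (x t))\<^sup>2 * exp (2 * t) \<le> (norm (x 0))\<^sup>2" by (simp add: dot_square_norm)
  then have "(norm (x t) * exp t)\<^sup>2 \<le> (norm (x 0))\<^sup>2"
    by (simp add: power_mult_distrib exp_double)
  then have "norm (x t) * exp t \<le> norm (x 0)" using power2_le_imp_le norm_ge_zero by blast
  then show ?thesis by (simp add: exp_minus field_simps)
qed

lemma radial_strategy_stabilizing:
  assumes k: "k \<ge> 1"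
  shows "stabilizing (radial_game Q) (radial_strategy k)"
  unfolding stabilizing_def
proof (intro conjI ballI allI impI)
  fix x0 :: "real ^ 'a" assume "x0 \<in> region (radial_game Q)"
  then show "\<exists>x. trajectory (radial_game Q) (radial_strategy k) x \<and> x (t_init (radial_game Q)) = x0"
    using radial_trajectory_exists[OF k, of x0 Q] by auto
next
  fix x assume x: "trajectory (radial_game Q) (radial_strategy k) x"
  have "((\<lambda>t. exp (- t) * norm (x 0)) \<longlongrightarrow> 0) at_top"
    by (intro tendsto_mult_left_zero filterlim_compose[OF exp_at_bot filterlim_uminus_at_bot_at_top])
  then show "(x \<longlongrightarrow> 0) at_top"
    by (rule Lim_null_comparison[rotated])
      (use radial_trajectory_decay[OF k x] in \<open>auto simp: eventually_at_top_linorder intro!: exI[of _ 0]\<close>)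
next
  fix e :: real assume "e > 0"
  have "norm (x t) < e" if "trajectory (radial_game Q) (radial_strategy k) x" "norm (x 0) < e" "t \<ge> 0" for x t
  proof -
    have "exp (- t) * norm (x 0) \<le> 1 * norm (x 0)" using that(3) by (intro mult_right_mono) auto
    then show ?thesis using radial_trajectory_decay[OF k that(1,3)] that(2) by simp
  qed
  then show "\<exists>d>0. \<forall>x. trajectory (radial_game Q) (radial_strategy k) x \<and> norm (x (t_init (radial_game Q))) < d \<longrightarrow>
        (\<forall>t\<ge>t_init (radial_game Q). norm (x t) < e)"
    using \<open>e > 0\<close> by auto
qed

lemma C2_on_inner_scaled: "C2_on X (\<lambda>x. c * inner x x)"
  by (intro C2_on_mult C2_on_const C2_on_inner_self)

text \<open>Along a closed-loop trajectory the running cost is the negative derivative of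
  \<open>k s\<close>, so its integral over a finite interval telescopes. Since the cost is
  nonnegative, the limit of these integrals is the integral over the half-line.\<close>

lemma radial_value_function:
  assumes k: "k \<ge> 1"
  shows "value_function (radial_game (radial_cost k)) (radial_strategy k) i (\<lambda>x. k * inner x x)"
  unfolding value_function_def
proof (intro conjI allI impI)
  show "C2_on (region (radial_game (radial_cost k))) (\<lambda>x. k * inner x x)"
    by (rule C2_on_inner_scaled)
next
  fix x t assume x: "trajectory (radial_game (radial_cost k)) (radial_strategy k) x"
    and "t_init (radial_game (radial_cost k)) \<le> t"
  then have t: "t \<ge> 0" by simp
  let ?s = "\<lambda>t. inner (x t) (x t)"
  let ?l = "\<lambda>\<tau>. radial_cost k (x \<tau>) + (k * ?s \<tau>)\<^sup>2"
  have int: "(?l has_integral (k * ?s t - k * ?s T)) {t..T}" if T: "t \<le> T" for T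
  proof -
    have "(?l has_integral (- k * ?s T - (- k * ?s t))) {t..T}"
    proof (rule fundamental_theorem_of_calculus[OF T])
      fix \<tau> assume "\<tau> \<in> {t..T}"
      then have "(?s has_real_derivative - 2 * (1 + (k - 1) * ?s \<tau>) * ?s \<tau>) (at \<tau> within {t..T})"
        using radial_trajectory_inner_derivative[OF x, of \<tau>] t by (auto intro: DERIV_subset)
      then show "((\<lambda>t. - k * ?s t) has_vector_derivative ?l \<tau>) (at \<tau> within {t..T})"
        unfolding has_real_derivative_iff_has_vector_derivative[symmetric]
        by (auto intro!: derivative_eq_intros simp: radial_cost_def power2_eq_square algebra_simps)
    qed
    then show ?thesis by simp
  qed
  have lim: "((\<lambda>T. k * ?s t - k * ?s T) \<longlongrightarrow> k * ?s t - k * 0) at_top"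
  proof -
    have "(x \<longlongrightarrow> 0) at_top"
      using radial_strategy_stabilizing[OF k] x unfolding stabilizing_def by blast
    from tendsto_inner[OF this this] have "(?s \<longlongrightarrow> 0) at_top" by simp
    from tendsto_diff[OF tendsto_const tendsto_mult[OF tendsto_const this]] show ?thesis .
  qed
  have "(?l has_integral k * ?s t) {t..}"
  proof (rule has_integral_to_inf)
    fix T show "?l integrable_on {t..T}"
      using int[of T] by (cases "t \<le> T") auto
    show "((\<lambda>T. integral {t..T} ?l) \<longlongrightarrow> k * ?s t) at_top"
    proof (rule Lim_transform_eventually)
      show "((\<lambda>T. k * ?s t - k * ?s T) \<longlongrightarrow> k * ?s t) at_top" using lim by simp
      show "\<forall>\<^sub>F T in at_top. k * ?s t - k * ?s T = integral {t..T} ?l"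
        unfolding eventually_at_top_linorder
        by (intro exI[of _ t] allI impI integral_unique[OF int, symmetric])
    qed
  next
    fix \<tau> assume "\<tau> \<ge> t"
    then have "x \<tau> \<in> cball 0 1" using x t by (auto simp: trajectory_radial)
    moreover have "0 \<le> k * ?s \<tau>" using k by simp
    ultimately have "0 \<le> radial_cost k (x \<tau>)" using radial_cost_nonneg[OF k] by (meson order_trans)
    then show "0 \<le> ?l \<tau>" by simp
  qed
  then show "((\<lambda>\<tau>. state_cost (radial_game (radial_cost k)) i (x \<tau>) +
      ctrl_penalty (radial_game (radial_cost k)) (radial_strategy k) i (x \<tau>)) has_integral k * inner (x t) (x t)) {t..}"
    by (simp add: ctrl_penalty_radial)
qed

lemma radial_admissible:
  assumes k: "k \<ge> 1"
  shows "admissible (radial_game (radial_cost k)) (radial_strategy k)"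
proof -
  have "C1_on (cball 0 1) (\<lambda>x :: real ^ 'a. - k * inner x x)"
    by (rule C2_on_imp_C1_on[OF C2_on_inner_scaled])
  moreover have "radial_strategy k i (0 :: real ^ 'a) = 0\<^sub>v 1" for i
    by (auto simp: radial_strategy_def)
  ultimately show ?thesis
    using radial_strategy_stabilizing[OF k] radial_value_function[OF k]
    unfolding admissible_def by auto
qed

section \<open>Optimality and uniqueness of the radial equilibrium\<close>

lemma radial_cost_continuous: "continuous_on X (radial_cost k)"
  unfolding radial_cost_def by (intro continuous_intros)

lemma radial_cost_zero [simp]: "radial_cost k 0 = 0"
  by (simp add: radial_cost_def)

text \<open>The verification argument for \<open>V = k s\<close>; its equality case is what makes
  the equilibrium unique.\<close>

lemma radial_optimal:
  assumes k: "k \<ge> 1" and \<nu>: "admissible (radial_game (radial_cost k)) \<nu>"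
    "value_function (radial_game (radial_cost k)) \<nu> 0 W" and x: "x \<in> cball 0 1"
  shows "k * inner x x \<le> W x" and "k * inner x x = W x \<Longrightarrow> \<nu> 0 x $ 0 = - k * inner x x"
proof -
  have d: "(\<lambda>x. k * inner x x) differentiable (at x)" for x :: "real ^ 'a"
    by (intro differentiable_mult differentiable_inner) auto
  have c: "continuous_on (cball 0 1) (\<lambda>x :: real ^ 'a. - k * inner x x)"
    by (intro continuous_intros)
  have H: "0 = (inner x x - 1 + - k * inner x x) * frechet_derivative (\<lambda>x. k * inner x x) (at x) x
        + (- k * inner x x)\<^sup>2 + radial_cost k x"
     "- k * inner x x = - frechet_derivative (\<lambda>x. k * inner x x) (at x) x / 2" for x :: "real ^ 'a"
    by (simp_all add: frechet_derivative_inner_self radial_cost_def power2_eq_square algebra_simps)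
  note v = radial_verification[OF d _ c radial_cost_continuous radial_cost_zero H \<nu> x]
  show "k * inner x x \<le> W x" using v(1) by simp
  show "\<nu> 0 x $ 0 = - k * inner x x" if "k * inner x x = W x" using v(2) that by simp
qed

text \<open>The sufficiency half of the characterization: a solution of the equation is compared
  with the value of every admissible deviation by completing the square.\<close>

lemma HJB_imp_FNE_radial:
  assumes \<mu>: "admissible (radial_game Q) \<mu>" "value_function (radial_game Q) \<mu> 0 (V 0)"
    and Q: "continuous_on (cball 0 1) Q" "Q 0 = 0"
    and HJB: "coupled_HJB (radial_game Q) \<mu> V"
  shows "is_FNE (radial_game Q) \<mu>"
proof -
  have C1: "C1_on (cball 0 1) (V 0)"
    using \<mu>(2) C2_on_imp_C1_on unfolding value_function_def by force
  have HJ: "0 = (inner x x - 1 + \<mu> 0 x $ 0) * frechet_derivative (V 0) (at x) x + (\<mu> 0 x $ 0)\<^sup>2 + Q x"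
    "\<mu> 0 x $ 0 = - frechet_derivative (V 0) (at x) x / 2" if x: "x \<in> cball 0 1" for x
  proof -
    have "linear (frechet_derivative (V 0) (at x))"
      by (rule linear_frechet_derivative[OF C1_on_imp_differentiable[OF C1 x]])
    note lin = linear_scale[OF this, unfolded real_scaleR_def]
    have "\<And>x. \<mu> 0 x \<in> carrier_vec 1" using admissible_radial(1)[OF \<mu>(1)] .
    from bspec[OF iffD1[OF coupled_HJB_radial[of \<mu> Q V, OF this] HJB] x]
    show "0 = (inner x x - 1 + \<mu> 0 x $ 0) * frechet_derivative (V 0) (at x) x + (\<mu> 0 x $ 0)\<^sup>2 + Q x"
      "\<mu> 0 x $ 0 = - frechet_derivative (V 0) (at x) x / 2"
      unfolding lin by blast+
  qed
  show ?thesis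
    unfolding is_FNE_def
  proof (intro conjI allI impI ballI)
    fix i \<nu> U W x
    assume i: "i < nplayers (radial_game Q)"
      and A: "admissible (radial_game Q) (\<mu>(i := \<nu>)) \<and>
        value_function (radial_game Q) \<mu> i U \<and> value_function (radial_game Q) (\<mu>(i := \<nu>)) i W"
      and x: "x \<in> region (radial_game Q)"
    have i0: "i = 0" using i by simp
    \<comment> \<open>The equilibrium property quantifies over all extensions of a value function
      beyond the region; on the region they coincide.\<close>
    have "U x = V 0 x" using value_function_unique[OF \<mu>(1) _ \<mu>(2) x] A i0 by blast
    also have "\<dots> \<le> W x"
    proof (rule radial_verification(1)[OF _ _ admissible_radial(3)[OF \<mu>(1)] Q HJ])
      show "V 0 0 = 0" by (rule value_function_radial_zero[OF \<mu> Q(2)])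
    qed (use A i0 x C1 in \<open>auto intro: C1_on_imp_differentiable\<close>)
    finally show "U x \<le> W x" .
  qed (rule \<mu>(1))
qed

lemma is_FNE_le:
  assumes "is_FNE g \<mu>" "i < nplayers g" "admissible g (\<mu>(i := \<nu>))"
    "value_function g \<mu> i V" "value_function g (\<mu>(i := \<nu>)) i W" "x \<in> region g"
  shows "V x \<le> W x"
  using assms unfolding is_FNE_def by blast

text \<open>Deviating to the radial strategy costs \<open>k s\<close>, so an equilibrium costs at
  most that. Verification gives the reverse inequality, and equality forces the same
  control.\<close>

lemma radial_FNE_imp:
  assumes k: "k \<ge> 1" and FNE: "is_FNE (radial_game (radial_cost k)) \<mu>"
    and V: "value_function (radial_game (radial_cost k)) \<mu> 0 V" and x: "x \<in> cball 0 1"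
  shows "V x = k * inner x x" and "\<mu> 0 x = radial_strategy k 0 x"
proof -
  let ?g = "radial_game (radial_cost k) :: 'a game"
  have \<mu>: "admissible ?g \<mu>" using FNE unfolding is_FNE_def by blast
  let ?\<nu> = "\<mu>(0 := radial_strategy k 0)"
  have "?\<nu> 0 = radial_strategy k 0" by simp
  note c = strategy_cong_radial[of ?\<nu> "radial_strategy k" "radial_cost k", OF this]
  have "admissible ?g ?\<nu>" "value_function ?g ?\<nu> 0 (\<lambda>x. k * inner x x)"
    using c radial_admissible[OF k] radial_value_function[OF k] by auto
  then have "V x \<le> k * inner x x"
    using is_FNE_le[OF FNE _ _ V, of "radial_strategy k 0" "\<lambda>x. k * inner x x" x] x by simp
  then show e: "V x = k * inner x x"
    using radial_optimal(1)[OF k \<mu> V x] by simp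
  have "\<mu> 0 x $ 0 = - k * inner x x"
    using radial_optimal(2)[OF k \<mu> V x] e by simp
  then show "\<mu> 0 x = radial_strategy k 0 x"
    using admissible_radial(1)[OF \<mu>, of x] by (intro eq_vecI) (auto simp: radial_strategy_def)
qed

text \<open>\<open>V 0\<close> is known on the closed ball only, so its derivative is first
  identified up to the boundary; the equation is then a polynomial identity in
  \<open>s\<close>.\<close>

lemma radial_HJB:
  assumes k: "k \<ge> 1"
    and V: "C1_on (cball 0 1) (V 0)" "\<And>x. x \<in> cball 0 1 \<Longrightarrow> V 0 x = k * inner x x"
    and \<mu>: "\<And>x. \<mu> 0 x \<in> carrier_vec 1" "\<And>x. x \<in> cball 0 1 \<Longrightarrow> \<mu> 0 x = radial_strategy k 0 x"
  shows "coupled_HJB (radial_game (radial_cost k)) \<mu> V"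
proof -
  have "frechet_derivative (V 0) (at x) = frechet_derivative (\<lambda>x. k * inner x x) (at x)"
    if "x \<in> cball 0 1" for x
    by (rule C1_on_frechet_derivative_cong[OF V(1) C2_on_imp_C1_on[OF C2_on_inner_scaled] V(2) that])
  then show ?thesis
    using \<mu> by (simp add: coupled_HJB_radial frechet_derivative_inner_self radial_cost_def
        power2_eq_square algebra_simps)
qed

lemma radial_differential_game:
  assumes k: "k \<ge> 1"
  shows "is_FNE (radial_game (radial_cost k) :: 'n::finite game) (radial_strategy k)"
    and "differential_game (radial_game (radial_cost k) :: 'n::finite game)"
proof -
  let ?g = "radial_game (radial_cost k) :: 'n game"
  show FNE: "is_FNE ?g (radial_strategy k)"
  proof (rule HJB_imp_FNE_radial[OF radial_admissible[OF k] radial_value_function[OF k]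
        radial_cost_continuous radial_cost_zero])
    show "coupled_HJB ?g (radial_strategy k) (\<lambda>i x. k * inner x x)"
      by (rule radial_HJB[OF k]) (auto intro: C2_on_imp_C1_on C2_on_inner_scaled)
  qed
  have unique: "unique_FNE ?g"
    unfolding unique_FNE_def
  proof (intro exI conjI allI impI ballI)
    fix \<nu> i x assume \<nu>: "is_FNE ?g \<nu>" "i < nplayers ?g" "x \<in> region ?g"
    obtain V where "value_function ?g \<nu> 0 V"
      using \<nu>(1) admissible_radial(5) unfolding is_FNE_def by blast
    then show "\<nu> i x = radial_strategy k i x"
      using radial_FNE_imp(2)[OF k \<nu>(1)] \<nu>(2,3) by simp
  qed (rule FNE)
  \<comment> \<open>Necessity holds because every equilibrium is the radial strategy with value
    \<open>k s\<close>; sufficiency is the verification argument.\<close>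
  have HJB: "HJB_characterizes_FNE ?g"
    unfolding HJB_characterizes_FNE_def
  proof (intro allI impI iffI; elim conjE)
    fix \<mu> V
    assume \<mu>: "admissible ?g \<mu>" and "\<forall>i<nplayers ?g. value_function ?g \<mu> i (V i)"
    then have V: "value_function ?g \<mu> 0 (V 0)" by simp
    show "coupled_HJB ?g \<mu> V" if "is_FNE ?g \<mu>"
    proof (rule radial_HJB[OF k])
      show "C1_on (cball 0 1) (V 0)"
        using V C2_on_imp_C1_on unfolding value_function_def by force
    qed (use radial_FNE_imp[OF k that V] admissible_radial(1)[OF \<mu>] in auto)
    show "is_FNE ?g \<mu>" if "coupled_HJB ?g \<mu> V"
      by (rule HJB_imp_FNE_radial[OF \<mu> V radial_cost_continuous radial_cost_zero that])
  qed
  have pd: "0 < radial_cost k x" if "x \<in> cball 0 1" "x \<noteq> 0" for x :: "real ^ 'n"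
  proof -
    have "0 < k * inner x x" using k that(2) by simp
    then show ?thesis using radial_cost_nonneg[OF k that(1)] by simp
  qed
  have s: "C1_on (cball 0 1) (\<lambda>x :: real ^ 'n. inner x x)"
    by (rule C2_on_imp_C1_on[OF C2_on_inner_self])
  have id: "C1_on (cball 0 1) (\<lambda>x :: real ^ 'n. x)"
    by (rule C1_on_bounded_linear[OF bounded_linear_ident])
  have drift: "C1_on (cball 0 1) (\<lambda>x :: real ^ 'n. (inner x x - 1) *\<^sub>R x)"
    by (auto intro!: C1_on_scaleR C1_on_diff s id C1_on_const)
  have cost: "C1_on (cball 0 1) (radial_cost k :: real ^ 'n \<Rightarrow> real)"
    unfolding radial_cost_def power2_eq_square by (intro C1_on_add C1_on_mult s C1_on_const)
  have sq: "scalar_prod v v = (v $ 0)\<^sup>2" if "v \<in> carrier_vec 1" for v :: "real vec"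
    using that by (simp add: scalar_prod_def power2_eq_square)
  have nz: "v $ 0 \<noteq> 0" if "v \<in> carrier_vec 1" "v \<noteq> 0\<^sub>v 1" for v :: "real vec"
    using that by (auto simp: vec_eq_iff)
  have weights: "sym_psd 1 (1\<^sub>m 1)" "sym_pd 1 (1\<^sub>m 1)"
    unfolding sym_psd_def sym_pd_def using sq nz by simp_all
  show "differential_game ?g"
    unfolding differential_game_def radial_game_simps
    using unique HJB drift cost id weights pd by (intro conjI allI impI ballI) auto
qed

section \<open>Moore--Penrose inverse and rank\<close>

text \<open>Dimension equations as premises, instead of carrier sets, let the simplifier rebracket
  long products.\<close>

lemma assoc_mult_mat_dim:
  fixes A B C :: "'a::semiring_0 mat"
  shows "dim_col A = dim_row B \<Longrightarrow> dim_col B = dim_row C \<Longrightarrow> A * B * C = A * (B * C)"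
  by (rule assoc_mult_mat[of A "dim_row A" "dim_col A" B "dim_col B" C "dim_col C"]) auto

lemma assoc_mult_mat_vec_dim:
  fixes A B :: "'a::semiring_0 mat"
  shows "dim_col A = dim_row B \<Longrightarrow> dim_col B = dim_vec v \<Longrightarrow> A * B *\<^sub>v v = A *\<^sub>v (B *\<^sub>v v)"
  by (rule assoc_mult_mat_vec[of A "dim_row A" "dim_col A" B "dim_col B" v]) auto

text \<open>Symmetry allows the factors in \<open>(A C) (A B)\<close> to be swapped under
  transposition, which gives \<open>A B = A C\<close>; likewise \<open>B A = C A\<close>. Then
  \<open>B = B A B = C A B = C A C = C\<close>.\<close>

lemma mp_inverse_unique:
  fixes A B C :: "real mat"
  assumes A: "A \<in> carrier_mat n m" and B: "B \<in> carrier_mat m n" and C: "C \<in> carrier_mat m n"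
    and AB: "A * B * A = A" "B * A * B = B"
      "transpose_mat (A * B) = A * B" "transpose_mat (B * A) = B * A"
    and AC: "A * C * A = A" "C * A * C = C"
      "transpose_mat (A * C) = A * C" "transpose_mat (C * A) = C * A"
  shows "B = C"
proof -
  have "A * B = (A * C * A) * B" using AC by simp
  also have "\<dots> = (A * C) * (A * B)" using A B C by (simp add: assoc_mult_mat_dim)
  also have "\<dots> = transpose_mat (A * C) * transpose_mat (A * B)" using AB AC by simp
  also have "\<dots> = transpose_mat ((A * B) * (A * C))"
    by (rule transpose_mult[symmetric, of _ n n _ n]) (use A B C in auto)
  also have "(A * B) * (A * C) = (A * B * A) * C" using A B C by (simp add: assoc_mult_mat_dim)
  also have "transpose_mat \<dots> = A * C" using AB AC by simp
  finally have e1: "A * B = A * C" .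
  have "B * A = B * (A * C * A)" using AC by simp
  also have "\<dots> = (B * A) * (C * A)"
    using A B C by (simp add: assoc_mult_mat_dim)
  also have "\<dots> = transpose_mat (B * A) * transpose_mat (C * A)" using AB AC by simp
  also have "\<dots> = transpose_mat ((C * A) * (B * A))"
    by (rule transpose_mult[symmetric, of _ m m _ m]) (use A B C in auto)
  also have "(C * A) * (B * A) = C * (A * B * A)" using A B C by (simp add: assoc_mult_mat_dim)
  also have "transpose_mat \<dots> = C * A" using AB AC by simp
  finally have e2: "B * A = C * A" .
  have "B = B * A * B" using AB by simp
  also have "\<dots> = C * (A * B)" using e2 A B C by (simp add: assoc_mult_mat_dim)
  also have "\<dots> = C * A * C" using e1 A B C by (simp add: assoc_mult_mat_dim)
  finally show ?thesis using AC by simp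
qed

lemma mp_inverse_eqI:
  assumes A: "A \<in> carrier_mat n m" and B: "B \<in> carrier_mat m n"
    and AB: "A * B * A = A" "B * A * B = B"
      "transpose_mat (A * B) = A * B" "transpose_mat (B * A) = B * A"
  shows "mp_inverse A = B"
  unfolding mp_inverse_def
proof (rule the_equality)
  show "B \<in> carrier_mat (dim_col A) (dim_row A) \<and> A * B * A = A \<and> B * A * B = B \<and>
     transpose_mat (A * B) = A * B \<and> transpose_mat (B * A) = B * A"
    using assms by auto
  fix C assume "C \<in> carrier_mat (dim_col A) (dim_row A) \<and> A * C * A = A \<and> C * A * C = C \<and>
     transpose_mat (A * C) = A * C \<and> transpose_mat (C * A) = C * A"
  then show "C = B" using mp_inverse_unique[OF A _ B _ _ _ _ AB, of C] A by auto
qed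

text \<open>If the Gram matrix kills \<open>y\<close>, then \<open>M\<^sup>T y\<close> has squared
  norm 0, and \<open>X\<^sup>T\<close> recovers \<open>y\<close> from it. So the kernel is trivial
  and the determinant nonzero.\<close>

lemma gram_inverse_exists:
  fixes M :: "real mat"
  assumes M: "M \<in> carrier_mat r n" and X: "X \<in> carrier_mat n r" and MX: "M * X = 1\<^sub>m r"
  obtains C where "C \<in> carrier_mat r r" "C * (M * transpose_mat M) = 1\<^sub>m r"
    "(M * transpose_mat M) * C = 1\<^sub>m r" "transpose_mat C = C"
proof -
  let ?G = "M * transpose_mat M"
  have G: "?G \<in> carrier_mat r r" using M by auto
  have inj: "y = 0\<^sub>v r" if y: "y \<in> carrier_vec r" "?G *\<^sub>v y = 0\<^sub>v r" for y
  proof -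
    let ?u = "transpose_mat M *\<^sub>v y"
    have u: "?u \<in> carrier_vec n" using M y by auto
    have "scalar_prod ?u ?u = scalar_prod y (M *\<^sub>v ?u)"
      using transpose_vec_mult_scalar[OF M u y(1)] by simp
    also have "M *\<^sub>v ?u = ?G *\<^sub>v y" using M y by (simp add: assoc_mult_mat_vec_dim)
    finally have "scalar_prod ?u ?u = 0" using y by simp
    then have "?u = 0\<^sub>v n" using u conjugate_square_eq_0_vec[OF u] by simp
    moreover have "transpose_mat X *\<^sub>v ?u = y"
    proof -
      have "transpose_mat X *\<^sub>v ?u = (transpose_mat X * transpose_mat M) *\<^sub>v y"
        using X M y by (simp add: assoc_mult_mat_vec_dim)
      also have "transpose_mat X * transpose_mat M = 1\<^sub>m r"
        using transpose_mult[OF M X] MX by simp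
      finally show ?thesis using y by simp
    qed
    ultimately show ?thesis using X by auto
  qed
  have "det ?G \<noteq> 0" using det_0_iff_vec_prod_zero[OF G] inj by auto
  from det_non_zero_imp_unit[OF G this] obtain C where
    C: "C \<in> carrier_mat r r" "C * ?G = 1\<^sub>m r" "?G * C = 1\<^sub>m r"
    unfolding Units_def ring_mat_def by auto
  \<comment> \<open>The Gram matrix is symmetric, so the transpose of its inverse is again an
    inverse.\<close>
  have "transpose_mat C = transpose_mat C * (?G * C)" using C by simp
  also have "\<dots> = (transpose_mat C * ?G) * C"
    using C G by (simp add: assoc_mult_mat_dim)
  also have "transpose_mat C * ?G = transpose_mat (?G * C)"
    using transpose_mult[OF G C(1)] transpose_mult[of M r n "transpose_mat M" r] M by simp
  finally have "transpose_mat C = C" using C by simp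
  with C that show ?thesis by blast
qed

text \<open>For full row rank and \<open>C\<close> the inverse of \<open>M M\<^sup>T\<close>, the
  pseudoinverse of \<open>M\<^sup>T M\<close> is \<open>M\<^sup>T C C M\<close>. Its product with
  \<open>M\<^sup>T M\<close> is the orthogonal projection \<open>P\<close> onto the row space. Hence
  least squares reproduces data of the form \<open>M \<theta>\<close>, even where it does not
  recover \<open>\<theta>\<close>.\<close>

lemma mp_inverse_gram:
  fixes M :: "real mat"
  assumes M: "M \<in> carrier_mat r n" and X: "X \<in> carrier_mat n r" and MX: "M * X = 1\<^sub>m r"
  shows "mp_inverse (transpose_mat M * M) \<in> carrier_mat n n"
    and "\<theta> \<in> carrier_vec n \<Longrightarrow>
      M *\<^sub>v (mp_inverse (transpose_mat M * M) *\<^sub>v (transpose_mat M *\<^sub>v (M *\<^sub>v \<theta>))) = M *\<^sub>v \<theta>"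
proof -
  let ?T = "transpose_mat M" and ?S = "transpose_mat M * M"
  obtain C where C: "C \<in> carrier_mat r r" "C * (M * ?T) = 1\<^sub>m r" "(M * ?T) * C = 1\<^sub>m r"
    "transpose_mat C = C"
    using gram_inverse_exists[OF M X MX] by blast
  have T: "?T \<in> carrier_mat n r" using M by simp
  define B where "B = ?T * (C * (C * M))"
  define P where "P = ?T * (C * M)"
  have B: "B \<in> carrier_mat n n" and P: "P \<in> carrier_mat n n"
    unfolding B_def P_def using M C T by auto
  have cancel: "M * (?T * (C * Y)) = Y" "C * (M * (?T * Y)) = Y" if "Y \<in> carrier_mat r n" for Y
  proof -
    have "M * (?T * (C * Y)) = ((M * ?T) * C) * Y" "C * (M * (?T * Y)) = (C * (M * ?T)) * Y"
      using M T C(1) that by (simp_all add: assoc_mult_mat_dim)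
    then show "M * (?T * (C * Y)) = Y" "C * (M * (?T * Y)) = Y"
      unfolding C(2,3) using that by simp_all
  qed
  have SB: "?S * B = P"
  proof -
    have "?S * B = ?T * (M * (?T * (C * (C * M))))"
      unfolding B_def using M T C by (simp add: assoc_mult_mat_dim)
    then show ?thesis using cancel(1)[of "C * M"] C M by (simp add: P_def)
  qed
  have BS: "B * ?S = P"
  proof -
    have "B * ?S = ?T * (C * (C * (M * (?T * M))))"
      unfolding B_def using M T C by (simp add: assoc_mult_mat_dim)
    then show ?thesis using cancel(2)[OF M] by (simp add: P_def)
  qed
  have Psym: "transpose_mat P = P"
  proof -
    have "transpose_mat P = transpose_mat (C * M) * M"
      unfolding P_def using transpose_mult[of ?T n r "C * M" n] C M T by simp
    also have "transpose_mat (C * M) = ?T * C" using transpose_mult[OF C(1) M] C(4) by simp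
    finally show ?thesis unfolding P_def using C M T by (simp add: assoc_mult_mat_dim)
  qed
  have PS: "P * ?S = ?S"
  proof -
    have "P * ?S = ?T * (C * (M * (?T * M)))"
      unfolding P_def using M T C by (simp add: assoc_mult_mat_dim)
    then show ?thesis using cancel(2)[OF M] by simp
  qed
  have PB: "P * B = B"
  proof -
    have "P * B = ?T * (C * (M * (?T * (C * (C * M)))))"
      unfolding P_def B_def using M T C by (simp add: assoc_mult_mat_dim)
    then show ?thesis using cancel(2)[of "C * (C * M)"] C M by (simp add: B_def)
  qed
  have mp: "mp_inverse ?S = B"
    by (rule mp_inverse_eqI[of _ n n]) (use M B SB BS Psym PS PB in auto)
  show "mp_inverse ?S \<in> carrier_mat n n" using mp B by simp
  assume \<theta>: "\<theta> \<in> carrier_vec n"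
  have "mp_inverse ?S *\<^sub>v (?T *\<^sub>v (M *\<^sub>v \<theta>)) = (B * ?S) *\<^sub>v \<theta>"
    unfolding mp using B M T \<theta> by (simp add: assoc_mult_mat_vec_dim)
  then have "M *\<^sub>v (mp_inverse ?S *\<^sub>v (?T *\<^sub>v (M *\<^sub>v \<theta>))) = (M * P) *\<^sub>v \<theta>"
    unfolding BS using M P \<theta> by (simp add: assoc_mult_mat_vec_dim)
  also have "M * P = M" unfolding P_def using cancel(1)[OF M] .
  finally show "M *\<^sub>v (mp_inverse ?S *\<^sub>v (?T *\<^sub>v (M *\<^sub>v \<theta>))) = M *\<^sub>v \<theta>" .
qed

section \<open>Bounds for the rank\<close>

lemma mat_rank_le_2:
  fixes A :: "real mat"
  assumes "\<And>r c. r < dim_row A \<Longrightarrow> c < dim_col A \<Longrightarrow> A $$ (r, c) = f r * g c + f' r * g' c"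
  shows "mat_rank A \<le> 2"
proof -
  let ?n = "dim_row A" and ?m = "dim_col A"
  \<comment> \<open>Two outer products of rank at most 1 each. The number of rows is arbitrary, so
    the bound covers every choice of data points.\<close>
  define B where "B = Matrix.mat ?n ?m (\<lambda>(r, c). f r * g c)"
  define C where "C = Matrix.mat ?n ?m (\<lambda>(r, c). f' r * g' c)"
  have "A = B + C" by (rule eq_matI) (auto simp: assms B_def C_def)
  moreover have "vec_space.rank ?n (B + C) \<le> vec_space.rank ?n B + vec_space.rank ?n C"
    by (rule vec_space.rank_subadditive[of _ _ ?m]) (auto simp: B_def C_def)
  moreover have "vec_space.rank ?n B \<le> 1"
    by (rule vec_space.rank_le_1_product_entries[of _ _ ?m f g]) (auto simp: B_def)
  moreover have "vec_space.rank ?n C \<le> 1"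
    by (rule vec_space.rank_le_1_product_entries[of _ _ ?m f' g']) (auto simp: C_def)
  ultimately show ?thesis unfolding mat_rank_def by simp
qed

lemma mult_mat_vec_in_span:
  fixes A :: "real mat"
  assumes A: "A \<in> carrier_mat r n" and v: "v \<in> carrier_vec n"
  shows "A *\<^sub>v v \<in> LinearCombinations.module.span class_ring (module_vec TYPE(real) r) (set (cols A))"
proof -
  interpret V: vec_space "TYPE(real)" r .
  have dims: "set (cols A) \<subseteq> carrier_vec r" using cols_dim[of A] A by simp
  have "\<forall>w\<in>set (cols A). dim_vec w = r" using dims by auto
  from V.lincomb_list_as_mat_mult[OF this, of "($) v"]
  have "A *\<^sub>v v = V.lincomb_list (($) v) (cols A)"
    using A v mat_of_cols_cols[of A] eq_vecI[of v "Matrix.vec n (($) v)"] by auto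
  then have "A *\<^sub>v v \<in> V.span_list (cols A)" unfolding V.span_list_def by auto
  then show ?thesis using V.span_list_as_span[OF dims] by simp
qed

text \<open>A right inverse writes each vector as an image under \<open>A\<close>, so the columns
  span the whole space.\<close>

lemma mat_rank_eq_rows:
  fixes A :: "real mat"
  assumes A: "A \<in> carrier_mat r n" and X: "X \<in> carrier_mat n r" and AX: "A * X = 1\<^sub>m r"
  shows "mat_rank A = r"
proof -
  interpret V: vec_space "TYPE(real)" r .
  have "V.span (set (cols A)) = carrier_vec r"
  proof
    show "V.span (set (cols A)) \<subseteq> carrier_vec r"
      using V.span_closed cols_dim A by (metis carrier_matD(1) subsetI)
    show "carrier_vec r \<subseteq> V.span (set (cols A))"
    proof
      fix v :: "real vec" assume v: "v \<in> carrier_vec r"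
      have "v = (A * X) *\<^sub>v v" using AX v by simp
      also have "\<dots> = A *\<^sub>v (X *\<^sub>v v)" using A X v by (simp add: assoc_mult_mat_vec)
      finally show "v \<in> V.span (set (cols A))" using mult_mat_vec_in_span[OF A, of "X *\<^sub>v v"] X v by auto
    qed
  qed
  then show ?thesis unfolding mat_rank_def using A V.dim_is_n by (simp add: V.rank_def module_vec_def)
qed

section \<open>The perturbed Hamilton--Jacobi--Bellman equation\<close>

lemma vec_of_list_append_vec: "vec_of_list (list_of_vec v @ xs) = v @\<^sub>v vec_of_list xs"
  by (metis list_of_vec_append list_vec vec_list)

lemma stack_vecs_Cons: "stack_vecs (v # vs) = v @\<^sub>v stack_vecs vs"
  by (simp add: stack_vecs_def vec_of_list_append_vec)

lemma hadamard_append: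
  "dim_vec v = dim_vec v' \<Longrightarrow> dim_vec w = dim_vec w' \<Longrightarrow> hadamard (v @\<^sub>v w) (v' @\<^sub>v w') = hadamard v v' @\<^sub>v hadamard w w'"
  by (rule eq_vecI) (auto simp: hadamard_def)

text \<open>Here the diagonality of the weights enters: only the squares of the control components
  survive in the quadratic form.\<close>

lemma hadamard_diagonal_form:
  fixes R :: "real mat"
  assumes u: "u \<in> carrier_vec d" and R: "R \<in> carrier_mat d d" "diagonal_mat R"
  shows "scalar_prod (hadamard u u) (vec_of_list (diag_mat R)) = scalar_prod u (R *\<^sub>v u)"
proof -
  have row: "scalar_prod (Matrix.row R k) u = R $$ (k, k) * u $ k" if "k < d" for k
  proof -
    have "scalar_prod (Matrix.row R k) u = (\<Sum>l\<in>{0..<d}. if l = k then R $$ (k, k) * u $ k else 0)"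
      unfolding scalar_prod_def carrier_vecD[OF u]
      by (rule sum.cong) (use R that in \<open>auto simp: diagonal_mat_def\<close>)
    then show ?thesis using that by simp
  qed
  show ?thesis
    unfolding scalar_prod_def[of u] scalar_prod_def[of "hadamard u u"]
    using u R row by (auto intro!: sum.cong simp: hadamard_def diag_mat_def vec_of_list_index)
qed

text \<open>The dimensions are proved in the same induction as the quadratic form, since splitting a
  scalar product at the join of two blocks needs matching lengths.\<close>

lemma stacked_quadratic_form:
  fixes R :: "nat \<Rightarrow> real mat"
  assumes "\<And>j. j \<in> set js \<Longrightarrow> u j \<in> carrier_vec (d j)"
    and "\<And>j. j \<in> set js \<Longrightarrow> R j \<in> carrier_mat (d j) (d j)"
    and "\<And>j. j \<in> set js \<Longrightarrow> diagonal_mat (R j)"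
  shows "dim_vec (stack_vecs (map u js)) = (\<Sum>j\<leftarrow>js. d j)"
    and "dim_vec (vec_of_list (concat (map (\<lambda>j. diag_mat (R j)) js))) = (\<Sum>j\<leftarrow>js. d j)"
    and "scalar_prod (hadamard (stack_vecs (map u js)) (stack_vecs (map u js)))
      (vec_of_list (concat (map (\<lambda>j. diag_mat (R j)) js))) = (\<Sum>j\<leftarrow>js. scalar_prod (u j) (R j *\<^sub>v u j))"
  using assms
proof (induction js)
  case Nil
  { case 1 then show ?case by (simp add: stack_vecs_def) }
  { case 2 then show ?case by simp }
  { case 3 then show ?case by (simp add: stack_vecs_def hadamard_def scalar_prod_def) }
next
  case (Cons j js)
  have u: "u j \<in> carrier_vec (d j)" and R: "R j \<in> carrier_mat (d j) (d j)" "diagonal_mat (R j)"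
    if "\<And>i. i \<in> set (j # js) \<Longrightarrow> u i \<in> carrier_vec (d i)"
      "\<And>i. i \<in> set (j # js) \<Longrightarrow> R i \<in> carrier_mat (d i) (d i)"
      "\<And>i. i \<in> set (j # js) \<Longrightarrow> diagonal_mat (R i)"
    using that by auto
  have Rd: "dim_row (R j) = d j" if "R j \<in> carrier_mat (d j) (d j)" using that by simp
  have diag: "vec_of_list (diag_mat (R j) @ concat (map (\<lambda>j. diag_mat (R j)) js)) =
      vec_of_list (diag_mat (R j)) @\<^sub>v vec_of_list (concat (map (\<lambda>j. diag_mat (R j)) js))"
    using vec_of_list_append_vec[of "vec_of_list (diag_mat (R j))"] by (simp add: list_vec)
  { case 1 then show ?case using Cons.IH(1) u[OF 1] by (simp add: stack_vecs_Cons) }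
  { case 2 then show ?case using Cons.IH(2) Rd[OF R(1)[OF 2]] by (simp add: diag diag_mat_def) }
  { case 3
    let ?S = "stack_vecs (map u js)" and ?w = "vec_of_list (concat (map (\<lambda>j. diag_mat (R j)) js))"
    have S: "hadamard ?S ?S \<in> carrier_vec (\<Sum>j\<leftarrow>js. d j)" "?w \<in> carrier_vec (\<Sum>j\<leftarrow>js. d j)"
      using Cons.IH(1,2) 3 by (auto simp: hadamard_def intro!: carrier_vecI)
    have "hadamard (u j) (u j) \<in> carrier_vec (d j)" "vec_of_list (diag_mat (R j)) \<in> carrier_vec (d j)"
      using u[OF 3] R[OF 3] by (auto simp: hadamard_def diag_mat_def intro!: carrier_vecI)
    from scalar_prod_append[OF this(1) S(1) this(2) S(2)]
    show ?case
      using hadamard_diagonal_form[OF u[OF 3] R[OF 3]] Cons.IH(3) 3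
      by (simp add: diag stack_vecs_Cons hadamard_append) }
qed

lemma frechet_derivative_scalar_prod:
  fixes \<phi> :: "'a::real_normed_vector \<Rightarrow> real vec"
  assumes \<theta>: "\<theta> \<in> carrier_vec n" and \<phi>: "\<And>x. \<phi> x \<in> carrier_vec n"
    and d: "\<And>j. j < n \<Longrightarrow> (\<lambda>y. \<phi> y $ j) differentiable (at x)"
  shows "frechet_derivative (\<lambda>y. scalar_prod \<theta> (\<phi> y)) (at x) v =
    scalar_prod \<theta> (Matrix.vec n (\<lambda>j. frechet_derivative (\<lambda>y. \<phi> y $ j) (at x) v))"
proof -
  have eq: "(\<lambda>y. scalar_prod \<theta> (\<phi> y)) = (\<lambda>y. \<Sum>j<n. \<theta> $ j * \<phi> y $ j)"
    using \<phi> by (auto simp: fun_eq_iff scalar_prod_def lessThan_atLeast0 carrier_vecD[OF \<phi>])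
  have "((\<lambda>y. scalar_prod \<theta> (\<phi> y)) has_derivative
      (\<lambda>h. \<Sum>j<n. \<theta> $ j * frechet_derivative (\<lambda>y. \<phi> y $ j) (at x) h)) (at x)"
    unfolding eq
  proof (rule has_derivative_sum)
    fix j assume "j \<in> {..<n}"
    then have "((\<lambda>y. \<phi> y $ j) has_derivative frechet_derivative (\<lambda>y. \<phi> y $ j) (at x)) (at x)"
      using d frechet_derivative_works by blast
    then show "((\<lambda>y. \<theta> $ j * \<phi> y $ j) has_derivative
        (\<lambda>h. \<theta> $ j * frechet_derivative (\<lambda>y. \<phi> y $ j) (at x) h)) (at x)"
      by (rule has_derivative_mult_right)
  qed
  from frechet_derivative_at[OF this]
  show ?thesis by (simp add: scalar_prod_def lessThan_atLeast0) (metis (lifting))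
qed

lemma C1_on_scalar_prod:
  fixes \<psi> :: "'a::real_normed_vector \<Rightarrow> real vec"
  assumes "\<And>x. \<psi> x \<in> carrier_vec m" "\<And>l. l < m \<Longrightarrow> C1_on X (\<lambda>x. \<psi> x $ l)"
  shows "C1_on X (\<lambda>x. scalar_prod \<beta> (\<psi> x))"
proof -
  have "(\<lambda>x. scalar_prod \<beta> (\<psi> x)) = (\<lambda>x. \<Sum>l<m. \<beta> $ l * \<psi> x $ l)"
    by (auto simp: fun_eq_iff scalar_prod_def lessThan_atLeast0 carrier_vecD[OF assms(1)])
  then show ?thesis
    by (simp only:) (intro C1_on_sum C1_on_mult C1_on_const assms(2), simp)
qed

text \<open>The residual is continuously differentiable, hence bounded on the compact region.
  Necessity of the coupled equations applies to the value functions
  \<open>\<theta>\<^sup>T \<phi>\<close>; linearity of the derivative and the diagonal weights bring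
  the equation into row form.\<close>

lemma residual_representation_exists:
  assumes H: "identification_hypotheses g \<mu> b \<theta> e xs" and i: "i < nplayers g"
    and \<beta>: "\<beta> \<in> carrier_vec (mdim b i)"
  shows "residual_representation g \<mu> b i \<beta> (\<theta> i) (\<lambda>x. state_cost g i x - scalar_prod \<beta> (psi b i x))"
proof -
  define V where "V i x = scalar_prod (\<theta> i) (phi b i x)" for i x
  have dg: "differential_game g" and comp: "compact (region g)" and FNE: "is_FNE g \<mu>"
    and diag: "\<And>j. j < nplayers g \<Longrightarrow> diagonal_mat (ctrl_cost g i j)"
    and \<phi>: "\<And>x. phi b i x \<in> carrier_vec (hdim b i)"
      "\<And>j. j < hdim b i \<Longrightarrow> C2_on (region g) (\<lambda>x. phi b i x $ j)"
    and \<theta>: "\<theta> i \<in> carrier_vec (hdim b i)"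
    and V: "\<And>i. i < nplayers g \<Longrightarrow> value_function g \<mu> i (V i)"
    and \<psi>: "\<And>x. psi b i x \<in> carrier_vec (mdim b i)"
    and SW: "\<exists>A. SW_subalgebra (region g) A \<and>
        (\<forall>i<nplayers g. \<forall>l<mdim b i. (\<lambda>x. psi b i x $ l) \<in> A)"
    using H i unfolding identification_hypotheses_def V_def by auto
  have \<psi>1: "C1_on (region g) (\<lambda>x. psi b i x $ l)" if "l < mdim b i" for l
    using SW i that unfolding SW_subalgebra_def by fastforce
  have \<mu>: "admissible g \<mu>" using FNE unfolding is_FNE_def by blast
  have "HJB_characterizes_FNE g" using dg unfolding differential_game_def by blast
  then have HJB: "coupled_HJB g \<mu> V"
    using \<mu> FNE V unfolding HJB_characterizes_FNE_def by blast
  have C1: "C1_on (region g) (\<lambda>x. state_cost g i x - scalar_prod \<beta> (psi b i x))"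
    using dg i unfolding differential_game_def by (intro C1_on_diff C1_on_scalar_prod[OF \<psi> \<psi>1]) auto
  have bd: "bounded ((\<lambda>x. state_cost g i x - scalar_prod \<beta> (psi b i x)) ` region g)"
    by (intro compact_imp_bounded compact_continuous_image C1_on_imp_continuous_on C1 comp)
  have uc: "\<And>j x. j < nplayers g \<Longrightarrow> \<mu> j x \<in> carrier_vec (cdim g j)"
    using \<mu> unfolding admissible_def by blast
  have Rc: "\<And>j. j < nplayers g \<Longrightarrow> ctrl_cost g i j \<in> carrier_mat (cdim g j) (cdim g j)"
    using dg i unfolding differential_game_def sym_psd_def by blast
  have "scalar_prod (HJB_row g b \<mu> i x) (weight_diag g i @\<^sub>v \<beta> @\<^sub>v \<theta> i) =
      - (state_cost g i x - scalar_prod \<beta> (psi b i x))" if x: "x \<in> region g" for x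
  proof -
    let ?p = "\<Sum>j\<leftarrow>[0..<nplayers g]. cdim g j" and ?c = "closed_loop g \<mu> x"
    let ?h = "hadamard (stacked_ctrl g \<mu> x) (stacked_ctrl g \<mu> x)"
    note q = stacked_quadratic_form[of "[0..<nplayers g]" "\<lambda>j. \<mu> j x" "cdim g" "ctrl_cost g i"]
    have q1: "?h \<in> carrier_vec ?p" "weight_diag g i \<in> carrier_vec ?p"
      using q(1,2) uc Rc diag by (auto simp: stacked_ctrl_def weight_diag_def hadamard_def intro!: carrier_vecI)
    have q2: "scalar_prod ?h (weight_diag g i) = ctrl_penalty g \<mu> i x"
      using q(3) uc Rc diag
      by (simp add: stacked_ctrl_def weight_diag_def ctrl_penalty_def sum_list_distinct_conv_sum_set
          atLeast0LessThan)
    have dV: "scalar_prod (phi_dir b i x ?c) (\<theta> i) = frechet_derivative (V i) (at x) ?c"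
    proof -
      have "frechet_derivative (V i) (at x) ?c = scalar_prod (\<theta> i) (phi_dir b i x ?c)"
        unfolding V_def phi_dir_def
        by (rule frechet_derivative_scalar_prod[OF \<theta> \<phi>(1)])
          (use \<phi>(2) x C2_on_imp_C1_on C1_on_imp_differentiable in blast)
      also have "\<dots> = scalar_prod (phi_dir b i x ?c) (\<theta> i)"
        by (rule comm_scalar_prod[OF \<theta>]) (simp add: phi_dir_def)
      finally show ?thesis by simp
    qed
    have pd: "phi_dir b i x ?c \<in> carrier_vec (hdim b i)" by (simp add: phi_dir_def)
    have "scalar_prod (HJB_row g b \<mu> i x) (weight_diag g i @\<^sub>v \<beta> @\<^sub>v \<theta> i) =
        ctrl_penalty g \<mu> i x + (scalar_prod (psi b i x) \<beta> + frechet_derivative (V i) (at x) ?c)"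
      unfolding HJB_row_def
      using scalar_prod_append[OF q1(1) _ q1(2), of "psi b i x @\<^sub>v phi_dir b i x ?c" "mdim b i + hdim b i" "\<beta> @\<^sub>v \<theta> i"]
        scalar_prod_append[OF \<psi> pd \<beta> \<theta>] q2 dV \<psi> pd \<beta> \<theta> by simp
    moreover have "scalar_prod (psi b i x) \<beta> = scalar_prod \<beta> (psi b i x)"
      by (rule comm_scalar_prod[OF \<psi> \<beta>])
    moreover have "0 = frechet_derivative (V i) (at x) ?c + ctrl_penalty g \<mu> i x + state_cost g i x"
      using HJB i x unfolding coupled_HJB_def by blast
    ultimately show ?thesis by simp
  qed
  then show ?thesis
    unfolding residual_representation_def using C1 bd by simp
qed

section \<open>The data of the counterexample\<close>

text \<open>
  The gradients of the first and the third component of \<open>phi\<close> coincide, which makes the matrix of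
  the strategy identification rank deficient for all demonstrations.
\<close>

definition radial_basis :: "'n::finite basis_data" where
  "radial_basis = \<lparr>hdim = (\<lambda>_. 3), hrel = (\<lambda>_. 3), mdim = (\<lambda>_. 1),
     phi = (\<lambda>_ x. Matrix.vec 3 (\<lambda>j. if j = 0 then inner x x else if j = 1 then (inner x x)\<^sup>2 else inner x x + 1)),
     psi = (\<lambda>_ x. Matrix.vec 1 (\<lambda>_. inner x x))\<rparr>"

text \<open>Two exact solutions of \<open>x' = - x\<close>, from \<open>v\<close> and from half of
  \<open>v\<close>, each sampled at time 0 only. Two different radii already give the maximal rank
  2.\<close>

definition radial_demos :: "real ^ 'n::finite \<Rightarrow> 'n demos" where
  "radial_demos v = \<lparr>ndemo = 2, nsamp = 1, tstep = 1,
     xdem = (\<lambda>d t. (exp (- t) / 2 ^ d) *\<^sub>R v),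
     udem = (\<lambda>i d t. radial_strategy 1 i ((exp (- t) / 2 ^ d) *\<^sub>R v))\<rparr>"

lemma radial_basis_simps [simp]:
  "hdim radial_basis i = 3" "hrel radial_basis i = 3" "mdim radial_basis i = 1"
  "phi radial_basis i x = Matrix.vec 3 (\<lambda>j. if j = 0 then inner x x else if j = 1 then (inner x x)\<^sup>2 else inner x x + 1)"
  "psi radial_basis i x = Matrix.vec 1 (\<lambda>_. inner x x)"
  by (simp_all add: radial_basis_def)

lemma sum_upt_3: "(\<Sum>j = 0..<3. f j) = f 0 + f 1 + f (2 :: nat)"
  by (simp add: numeral_3_eq_3 numeral_2_eq_2)

text \<open>For \<open>j < 3\<close>, the factor of \<open>inner x h\<close> in the derivative of
  basis function \<open>j\<close> at \<open>x\<close> in direction \<open>h\<close>.\<close>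

definition radial_slope :: "nat \<Rightarrow> real ^ 'n::finite \<Rightarrow> real" where
  "radial_slope j x = (if j = 1 then 4 * inner x x else 2)"

lemma radial_basis_derivative:
  assumes "j < 3"
  shows "((\<lambda>y. phi radial_basis i y $ j) has_derivative (\<lambda>h. radial_slope j x * inner x h)) (at x)"
proof -
  consider "j = 0" | "j = 1" | "j = 2" using assms by linarith
  then show ?thesis
  proof cases
    case 1
    then show ?thesis by (auto intro!: derivative_eq_intros simp: radial_slope_def inner_commute)
  next
    case 2
    then show ?thesis by (auto intro!: derivative_eq_intros simp: radial_slope_def inner_commute)
  next
    case 3
    then show ?thesis by (auto intro!: derivative_eq_intros simp: radial_slope_def inner_commute)
  qed
qed

lemma radial_basis_frechet:
  assumes "j < 3"
  shows "frechet_derivative (\<lambda>y. phi radial_basis i y $ j) (at x) h = radial_slope j x * inner x h"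
  using frechet_derivative_at[OF radial_basis_derivative[OF assms]] by metis

lemma radial_basis_C2:
  assumes "j < 3"
  shows "C2_on X (\<lambda>y. phi radial_basis i y $ j)"
proof -
  consider "j = 0" | "j = 1" | "j = 2" using assms by linarith
  then show ?thesis
    by cases (simp_all add: power2_eq_square C2_on_add C2_on_mult C2_on_const C2_on_inner_self)
qed

lemma radial_input_grad:
  assumes "j < 3"
  shows "input_grad (radial_game Q) i (\<lambda>y. phi radial_basis i y $ j) x =
    Matrix.vec 1 (\<lambda>_. radial_slope j x * inner x x)"
  unfolding input_grad_def radial_game_simps radial_basis_frechet[OF assms] ..

lemma radial_Phi_bar:
  "Phi_bar (radial_game Q) radial_basis i x =
    Matrix.mat 1 3 (\<lambda>(k, c). radial_slope c x * inner x x)"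
proof (rule eq_matI)
  fix k c
  assume "k < dim_row (Matrix.mat 1 3 (\<lambda>(k, c). radial_slope c x * inner x x))"
    and "c < dim_col (Matrix.mat 1 3 (\<lambda>(k, c). radial_slope c x * inner x x))"
  then have "k = 0" and c: "c < 3" by auto
  then show "Phi_bar (radial_game Q) radial_basis i x $$ (k, c) =
      Matrix.mat 1 3 (\<lambda>(k, c). radial_slope c x * inner x x) $$ (k, c)"
    using radial_input_grad[OF c, of Q i x] unfolding Phi_bar_def by simp
qed (simp_all add: Phi_bar_def)

lemma radial_M_u:
  "M_u (radial_game Q) radial_basis e i = mat_of_rows 3
    (map (\<lambda>(d, t). Matrix.vec 3 (\<lambda>c. - (radial_slope c (xdem e d t) * inner (xdem e d t) (xdem e d t)) / 2))
      (samples (radial_game Q) e))"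
proof -
  have "Matrix.rows ((- 1 / 2) \<cdot>\<^sub>m Phi_bar (radial_game Q) radial_basis i x) =
      [Matrix.vec 3 (\<lambda>c. - (radial_slope c x * inner x x) / 2)]" for x
    unfolding radial_Phi_bar Matrix.rows_def by (auto intro!: eq_vecI)
  then show ?thesis
    unfolding M_u_def by (simp add: case_prod_unfold concat_map_singleton)
qed

text \<open>A sample of squared norm \<open>s\<close> contributes the row
  \<open>s (-1, 0, -1) + s\<^sup>2 (0, -2, 0)\<close>, so all rows lie in one plane for any
  demonstrations.\<close>

lemma radial_M_u_rank: "mat_rank (M_u (radial_game Q) radial_basis e i) \<le> 2"
proof -
  let ?l = "samples (radial_game Q) e"
  define s where "s r = inner (xdem e (fst (?l ! r)) (snd (?l ! r))) (xdem e (fst (?l ! r)) (snd (?l ! r)))" for r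
  show ?thesis
    by (rule mat_rank_le_2[of _ s "\<lambda>c. if c = 1 then 0 else - 1" "\<lambda>r. (s r)\<^sup>2" "\<lambda>c. if c = 1 then - 2 else 0"])
      (auto simp: radial_M_u mat_of_rows_def s_def case_prod_unfold radial_slope_def power2_eq_square)
qed

lemma samples_radial_demos: "samples (radial_game Q) (radial_demos v) = [(0, 0), (1, 0)]"
  by (simp add: samples_def radial_demos_def numeral_2_eq_2)

lemma radial_demos_simps [simp]:
  "xdem (radial_demos v) d t = (exp (- t) / 2 ^ d) *\<^sub>R v"
  "udem (radial_demos v) i d t = radial_strategy 1 i ((exp (- t) / 2 ^ d) *\<^sub>R v)"
  by (simp_all add: radial_demos_def)

section \<open>Identification of the strategy from two samples\<close>

context
  fixes v :: "real ^ 'n::finite"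
  assumes v: "norm v = 1"
begin

lemma inner_v: "inner v v = 1"
  using v by (simp add: dot_square_norm)

lemma radial_demos_M_u:
  "M_u (radial_game Q) radial_basis (radial_demos v) i =
    mat_of_rows_list 3 [[- 1, - 2, - 1], [- 1 / 4, - 1 / 8, - 1 / 4]]"
  unfolding radial_M_u samples_radial_demos mat_of_rows_def mat_of_rows_list_def
  by (rule eq_matI) (auto simp: inner_v radial_slope_def less_Suc_eq numeral_3_eq_3 numeral_2_eq_2)

text \<open>The inverse of the block formed by the first two columns, padded with a zero
  row.\<close>

lemma radial_demos_right_inverse:
  "M_u (radial_game Q) radial_basis (radial_demos v) i
     * mat_of_rows_list 2 [[1 / 3, - 16 / 3], [- 2 / 3, 8 / 3], [0, 0]] = 1\<^sub>m 2"
  unfolding radial_demos_M_u mat_of_rows_list_def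
  by (rule eq_matI) (auto simp: scalar_prod_def sum_upt_3 less_Suc_eq numeral_2_eq_2)

lemma radial_demos_M_u_carrier:
  "M_u (radial_game Q) radial_basis (radial_demos v) i \<in> carrier_mat 2 3"
  unfolding radial_demos_M_u mat_of_rows_list_def by (simp add: numeral_2_eq_2)

lemma radial_demos_M_u_mult:
  assumes "u \<in> carrier_vec 3"
  shows "(M_u (radial_game Q) radial_basis (radial_demos v) i *\<^sub>v u) $ 0 = - (u $ 0 + 2 * u $ 1 + u $ 2)"
    "(M_u (radial_game Q) radial_basis (radial_demos v) i *\<^sub>v u) $ 1 = - (u $ 0 / 4 + u $ 1 / 8 + u $ 2 / 4)"
  using assms unfolding radial_demos_M_u mat_of_rows_list_def
  by (simp_all add: scalar_prod_def sum_upt_3 numeral_2_eq_2)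

text \<open>The two samples fix only \<open>?t $ 1 = 0\<close> and
  \<open>?t $ 0 + ?t $ 2 = 1\<close>. The feedback depends on the coefficients through these
  quantities alone, so it is identified exactly although the parameters are not.\<close>

lemma radial_mu_hat:
  "mu_hat (radial_game Q) radial_basis (radial_demos v) = radial_strategy 1"
proof (intro ext)
  fix i x
  let ?M = "M_u (radial_game Q) radial_basis (radial_demos v) i"
  let ?\<theta> = "Matrix.vec 3 (\<lambda>j. if j = 0 then 1 else 0) :: real vec"
  let ?t = "theta_bar_hat (radial_game Q) radial_basis (radial_demos v) i"
  have X: "mat_of_rows_list 2 [[1 / 3, - 16 / 3], [- 2 / 3, 8 / 3], [0, 0]] \<in> carrier_mat 3 2"
    by (simp add: mat_of_rows_list_def numeral_3_eq_3)
  \<comment> \<open>The observed controls are generated by the coefficients of the value function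
    \<open>s\<close>, so the data lie in the range of the matrix.\<close>
  have z: "z_u (radial_game Q) (radial_demos v) i = ?M *\<^sub>v ?\<theta>"
  proof (rule eq_vecI)
    show "dim_vec (z_u (radial_game Q) (radial_demos v) i) = dim_vec (?M *\<^sub>v ?\<theta>)"
      using radial_demos_M_u_carrier[of Q i]
      by (simp add: z_u_def samples_radial_demos stack_vecs_def radial_strategy_def)
    fix k assume "k < dim_vec (?M *\<^sub>v ?\<theta>)"
    then consider "k = 0" | "k = 1" using radial_demos_M_u_carrier[of Q i] by fastforce
    then show "z_u (radial_game Q) (radial_demos v) i $ k = (?M *\<^sub>v ?\<theta>) $ k"
      by cases (simp_all add: radial_demos_M_u_mult[unfolded One_nat_def] z_u_def samples_radial_demos stack_vecs_def
          radial_strategy_def inner_v)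
  qed
  note P = mp_inverse_gram[OF radial_demos_M_u_carrier[of Q i] X radial_demos_right_inverse]
  have "?M *\<^sub>v ?t = ?M *\<^sub>v ?\<theta>"
    unfolding theta_bar_hat_def Let_def z by (rule P(2)) simp
  moreover have t: "?t \<in> carrier_vec 3"
    unfolding theta_bar_hat_def Let_def by (rule mult_mat_vec_carrier[OF P(1)])
      (use radial_demos_M_u_carrier[of Q i] z in auto)
  ultimately have "?t $ 0 + 2 * ?t $ 1 + ?t $ 2 = 1" "?t $ 0 / 4 + ?t $ 1 / 8 + ?t $ 2 / 4 = 1 / 4"
    using radial_demos_M_u_mult[of ?t Q i] radial_demos_M_u_mult[of ?\<theta> Q i] by auto
  then have e: "?t $ 1 = 0" "?t $ 0 = 1 - ?t $ 2" by auto
  show "mu_hat (radial_game Q) radial_basis (radial_demos v) i x = radial_strategy 1 i x"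
  proof (rule eq_vecI)
    fix k assume "k < dim_vec (radial_strategy 1 i x)"
    then have "k = 0" by (simp add: radial_strategy_def)
    have "mu_hat (radial_game Q) radial_basis (radial_demos v) i x $ 0 =
        - inner x x * (?t $ 0 + 2 * inner x x * ?t $ 1 + ?t $ 2)"
      using t unfolding mu_hat_def radial_Phi_bar
      by (simp add: scalar_prod_def sum_upt_3 radial_slope_def algebra_simps)
    then show "mu_hat (radial_game Q) radial_basis (radial_demos v) i x $ k = radial_strategy 1 i x $ k"
      unfolding e \<open>k = 0\<close> by simp
  qed (simp add: mu_hat_def radial_Phi_bar radial_strategy_def)
qed

section \<open>Identification of the cost\<close>

lemma radial_HJB_row:
  "HJB_row (radial_game Q) radial_basis (radial_strategy 1) i x =
    vec_of_list [(inner x x)\<^sup>2, inner x x, - 2 * inner x x, - 4 * (inner x x)\<^sup>2, - 2 * inner x x]"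
proof -
  have cl: "closed_loop (radial_game Q) (radial_strategy 1) x = - x"
    by (simp add: closed_loop_radial)
  have "phi_dir radial_basis i x (- x) = vec_of_list [- 2 * inner x x, - 4 * (inner x x)\<^sup>2, - 2 * inner x x]"
    unfolding phi_dir_def
    by (rule eq_vecI)
      (auto simp: radial_basis_frechet radial_slope_def less_Suc_eq numeral_3_eq_3 power2_eq_square
        simp del: radial_basis_simps(4))
  moreover have "hadamard (stacked_ctrl (radial_game Q) (radial_strategy 1) x)
      (stacked_ctrl (radial_game Q) (radial_strategy 1) x) = vec_of_list [(inner x x)\<^sup>2]"
    by (rule eq_vecI) (auto simp: hadamard_def stacked_ctrl_def stack_vecs_def radial_strategy_def power2_eq_square)
  moreover have "psi radial_basis i x = vec_of_list [inner x x]"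
    by (rule eq_vecI) auto
  ultimately show ?thesis
    unfolding HJB_row_def cl
    using vec_of_list_append_vec[of "vec_of_list [(inner x x)\<^sup>2]"] vec_of_list_append_vec[of "vec_of_list [inner x x]"]
    by (simp add: list_vec)
qed

lemma radial_M_HJB:
  "M_HJB (radial_game Q) radial_basis (radial_demos v) ys i = mat_of_rows 5 (map (\<lambda>x.
    vec_of_list [(inner x x)\<^sup>2, inner x x, - 2 * inner x x, - 4 * (inner x x)\<^sup>2, - 2 * inner x x]) ys)"
  unfolding M_HJB_def radial_mu_hat radial_HJB_row by (simp add: cdim_total_def)

text \<open>Every row is a combination of two fixed vectors with coefficients
  \<open>s\<^sup>2\<close> and \<open>s\<close>.\<close>

lemma radial_M_HJB_rank:
  "mat_rank (M_HJB (radial_game Q) radial_basis (radial_demos v) ys i) \<le> 2"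
proof -
  define s where "s r = inner (ys ! r) (ys ! r)" for r
  show ?thesis
    by (rule mat_rank_le_2[of _ "\<lambda>r. (s r)\<^sup>2" "\<lambda>c. [1, 0, 0, - 4, 0] ! c" s "\<lambda>c. [0, 1, - 2, 0, - 2] ! c"])
      (auto simp: radial_M_HJB mat_of_rows_def s_def vec_of_list_index less_Suc_eq eval_nat_numeral)
qed

lemma radial_M_HJB_points:
  "M_HJB (radial_game Q) radial_basis (radial_demos v) [v, (1 / 2) *\<^sub>R v] i =
    mat_of_rows_list 5 [[1, 1, - 2, - 4, - 2], [1 / 16, 1 / 4, - 1 / 2, - 1 / 4, - 1 / 2]]"
  unfolding radial_M_HJB mat_of_rows_def mat_of_rows_list_def
  by (rule eq_matI) (auto simp: inner_v vec_of_list_index less_Suc_eq eval_nat_numeral)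

text \<open>Again the inverse of the first two columns, padded with zero rows.\<close>

lemma radial_M_HJB_right_inverse:
  "M_HJB (radial_game Q) radial_basis (radial_demos v) [v, (1 / 2) *\<^sub>R v] i
    * mat_of_rows_list 2 [[4 / 3, - 16 / 3], [- 1 / 3, 16 / 3], [0, 0], [0, 0], [0, 0]] = 1\<^sub>m 2"
  unfolding radial_M_HJB_points mat_of_rows_list_def
  by (rule eq_matI) (auto simp: scalar_prod_def less_Suc_eq eval_nat_numeral)

lemma radial_M_HJB_carrier:
  "M_HJB (radial_game Q) radial_basis (radial_demos v) [v, (1 / 2) *\<^sub>R v] i \<in> carrier_mat 2 5"
  unfolding radial_M_HJB_points mat_of_rows_list_def by (simp add: numeral_2_eq_2)

text \<open>
  The vector \<open>w\<close> is orthogonal to all data rows, so the solution is its projection. Its first two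
  entries encode the weight \<open>1\<close> and the state cost \<open>4 s = radial_cost 2\<close>, where \<open>s\<close> is the squared norm.
\<close>

lemma radial_HJB_solution:
  defines "w \<equiv> vec_of_list [1, 4, 2, 1 / 4, 0]"
  shows "HJB_solution (radial_game Q) radial_basis (radial_demos v) [v, (1 / 2) *\<^sub>R v] i w = vec_of_list [1, 4]"
proof -
  let ?M = "M_HJB (radial_game Q) radial_basis (radial_demos v) [v, (1 / 2) *\<^sub>R v] i"
  let ?S = "transpose_mat ?M * ?M"
  define P where "P = mp_inverse ?S"
  define L where "L = Matrix.mat 2 5 (\<lambda>(r, c). if r = c then 1 else 0 :: real)"
  have M: "?M \<in> carrier_mat 2 5" by (rule radial_M_HJB_carrier)
  have X: "mat_of_rows_list 2 [[4 / 3, - 16 / 3], [- 1 / 3, 16 / 3], [0, 0], [0, 0], [0, 0]] \<in> carrier_mat 5 2"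
    by (simp add: mat_of_rows_list_def eval_nat_numeral)
  have P: "P \<in> carrier_mat 5 5"
    unfolding P_def by (rule mp_inverse_gram(1)[OF M X radial_M_HJB_right_inverse])
  have w: "w \<in> carrier_vec 5" by (simp add: w_def carrier_vecI)
  \<comment> \<open>The last three entries of \<open>w\<close> encode
    \<open>2 s + s\<^sup>2 / 4\<close>, whose derivative along \<open>x' = - x\<close> cancels the
    running cost \<open>s\<^sup>2 + 4 s\<close> given by the first two.\<close>
  have Mw: "?M *\<^sub>v w = 0\<^sub>v 2"
    unfolding radial_M_HJB_points mat_of_rows_list_def w_def
    by (rule eq_vecI) (auto simp: scalar_prod_def less_Suc_eq eval_nat_numeral)
  have L: "L \<in> carrier_mat 2 5" by (simp add: L_def)
  have zero: "A *\<^sub>v 0\<^sub>v n = 0\<^sub>v m" if "A \<in> carrier_mat m n" for A :: "real mat" and m n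
    by (rule eq_vecI) (use that in auto)
  have "HJB_solution (radial_game Q) radial_basis (radial_demos v) [v, (1 / 2) *\<^sub>R v] i w =
      (L * P * transpose_mat ?M) *\<^sub>v 0\<^sub>v 2 + (L * (1\<^sub>m 5 - P * ?S)) *\<^sub>v w"
    by (simp add: HJB_solution_def Let_def cdim_total_def L_def P_def numeral_2_eq_2)
  also have "(L * P * transpose_mat ?M) *\<^sub>v 0\<^sub>v 2 = 0\<^sub>v 2"
    by (rule zero) (use L P M in auto)
  also have "(L * (1\<^sub>m 5 - P * ?S)) *\<^sub>v w = L *\<^sub>v (w - P *\<^sub>v (transpose_mat ?M *\<^sub>v (?M *\<^sub>v w)))"
    using L P M w by (simp add: assoc_mult_mat_vec_dim minus_mult_distrib_mat_vec[of _ 5 5])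
  \<comment> \<open>The kernel projection fixes \<open>w\<close>, and \<open>L\<close> extracts its
    weight and state-cost entries.\<close>
  also have "\<dots> = L *\<^sub>v w"
    unfolding Mw using zero[OF P] zero[of "transpose_mat ?M" 5 2] M w by simp
  also have "\<dots> = vec_of_list [1, 4]"
    unfolding L_def w_def
    by (rule eq_vecI) (auto simp: scalar_prod_def less_Suc_eq eval_nat_numeral)
  also have "0\<^sub>v 2 + vec_of_list [1, 4 :: real] = vec_of_list [1, 4]"
    by (rule left_zero_vec) (simp add: carrier_vecI)
  finally show ?thesis .
qed

section \<open>The hypotheses for the observed radial game\<close>

lemma radial_valid_demos:
  "valid_demos (radial_game Q) (radial_strategy 1) (radial_demos v)"
proof -
  have "trajectory (radial_game Q) (radial_strategy 1) (xdem (radial_demos v) d)" for d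
    unfolding trajectory_radial_strategy
  proof (intro allI impI conjI)
    fix t :: real assume t: "t \<ge> 0"
    have "exp (- t) \<le> 2 ^ d" using t one_le_power[of "2 :: real" d] exp_le_one_iff[of "- t"] by linarith
    then show "xdem (radial_demos v) d t \<in> cball 0 1" using v by simp
    have "((\<lambda>t. exp (- t) / 2 ^ d) has_real_derivative - (exp (- t) / 2 ^ d)) (at t within {0..})"
      by (auto intro!: derivative_eq_intros)
    from has_vector_derivative_scaleR[OF this has_vector_derivative_const[of v]]
    show "(xdem (radial_demos v) d has_vector_derivative
        - (1 + (1 - 1) * inner (xdem (radial_demos v) d t) (xdem (radial_demos v) d t)) *\<^sub>R xdem (radial_demos v) d t)
        (at t within {0..})"
      by (simp add: radial_demos_def)
  qed
  then show ?thesis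
    unfolding valid_demos_def by (simp add: radial_demos_def)
qed

text \<open>The quotient of the cost by \<open>s\<close> is \<open>2 - s\<close>, which takes the
  values 1 and 7/4 at the radii 1 and 1/2.\<close>

lemma radial_cost_not_spanned:
  "\<not> (\<exists>c\<in>carrier_vec 1. \<forall>x\<in>cball 0 1. radial_cost 1 (x :: real ^ 'n) = scalar_prod c (psi radial_basis i x))"
proof (intro notI, elim bexE)
  fix c :: "real vec" assume c: "c \<in> carrier_vec 1"
    "\<forall>x\<in>cball 0 1. radial_cost 1 (x :: real ^ 'n) = scalar_prod c (psi radial_basis i x)"
  have eq: "2 * inner x x - (inner x x)\<^sup>2 = c $ 0 * inner x x" if "x \<in> cball 0 1" for x :: "real ^ 'n"
    using c that by (simp add: radial_cost_def scalar_prod_def)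
  have "c $ 0 = 1" using eq[of v] v by (simp add: inner_v)
  moreover have "c $ 0 = 7 / 4" using eq[of "(1 / 2) *\<^sub>R v"] v by (simp add: inner_v power2_eq_square)
  ultimately show False by simp
qed

text \<open>Both data matrices have rank 2 for the chosen points, and 2 bounds the rank for every
  choice, so the ranks are maximal; the first is still below 3.\<close>

lemma radial_identification_hypotheses:
  "identification_hypotheses (radial_game (radial_cost 1)) (radial_strategy 1) radial_basis
     (\<lambda>_. Matrix.vec 3 (\<lambda>j. if j = 0 then 1 else 0)) (radial_demos v) [v, (1 / 2) *\<^sub>R v]"
proof -
  let ?g = "radial_game (radial_cost 1) :: 'n game"
  have rank_u: "mat_rank (M_u ?g radial_basis (radial_demos v) i) = 2" for i
    by (rule mat_rank_eq_rows[OF radial_demos_M_u_carrier _ radial_demos_right_inverse])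
      (simp add: mat_of_rows_list_def numeral_3_eq_3)
  have rank_HJB: "mat_rank (M_HJB ?g radial_basis (radial_demos v) [v, (1 / 2) *\<^sub>R v] i) = 2" for i
    by (rule mat_rank_eq_rows[OF radial_M_HJB_carrier _ radial_M_HJB_right_inverse])
      (simp add: mat_of_rows_list_def eval_nat_numeral)
  have split: "split_basis ?g radial_basis i" for i
    unfolding split_basis_def
  proof (intro conjI allI impI)
    fix j assume j: "j < hrel (radial_basis :: 'n basis_data) i"
    have "input_grad ?g i (\<lambda>y. phi radial_basis i y $ j) v $ 0 \<noteq> 0"
      using j by (subst radial_input_grad) (simp_all add: radial_slope_def inner_v)
    then have "input_grad ?g i (\<lambda>y. phi radial_basis i y $ j) v \<noteq> 0\<^sub>v (cdim ?g i)" by auto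
    then show "\<exists>x\<in>region ?g. input_grad ?g i (\<lambda>y. phi radial_basis i y $ j) x \<noteq> 0\<^sub>v (cdim ?g i)"
      using v by (intro bexI[of _ v]) auto
  qed simp_all
  have V: "(\<lambda>x. scalar_prod (Matrix.vec 3 (\<lambda>j. if j = 0 then 1 else 0)) (phi radial_basis i x)) =
      (\<lambda>x :: real ^ 'n. 1 * inner x x)" for i
    by (simp add: scalar_prod_def sum_upt_3)
  \<comment> \<open>The algebra of all bounded continuously differentiable functions serves: linear
    functionals separate points and constants do not vanish.\<close>
  define A where "A = {h. bounded (h ` cball (0 :: real ^ 'n) 1) \<and> C1_on (cball 0 1) (h :: real ^ 'n \<Rightarrow> real)}"
  have A: "h \<in> A" if "C1_on (cball 0 1) h" for h
    using that compact_imp_bounded[OF compact_continuous_image[OF C1_on_imp_continuous_on[OF that] compact_cball]]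
    unfolding A_def by simp
  have SW: "SW_subalgebra (region ?g) A"
    unfolding SW_subalgebra_def
  proof (intro conjI ballI allI impI)
    fix x y :: "real ^ 'n" assume "x \<noteq> y"
    have "(\<lambda>z. inner (x - y) z) \<in> A"
      by (intro A C1_on_bounded_linear bounded_linear_inner_right)
    moreover have "inner (x - y) x \<noteq> inner (x - y) y"
      using \<open>x \<noteq> y\<close> inner_eq_zero_iff[of "x - y"] by (simp add: inner_diff_right)
    ultimately show "\<exists>h\<in>A. h x \<noteq> h y" by blast
  next
    fix x :: "real ^ 'n"
    have "(\<lambda>_. 1) \<in> A" by (intro A C1_on_const)
    then show "\<exists>h\<in>A. h x \<noteq> 0" by force
  next
    fix h k :: "real ^ 'n \<Rightarrow> real" and c :: real assume "h \<in> A" "k \<in> A"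
    then show "(\<lambda>x. h x + k x) \<in> A" "(\<lambda>x. h x * k x) \<in> A"
      by (auto simp: A_def intro!: A[unfolded A_def mem_Collect_eq] C1_on_add C1_on_mult)
  next
    fix h :: "real ^ 'n \<Rightarrow> real" and c :: real assume "h \<in> A"
    then show "(\<lambda>x. c * h x) \<in> A"
      by (intro A C1_on_mult C1_on_const) (simp add: A_def)
  qed (auto simp: A_def)
  have \<psi>: "(\<lambda>x. psi radial_basis i x $ l) \<in> A" if "l < mdim (radial_basis :: 'n basis_data) i" for i l
    using that by (simp add: A C2_on_imp_C1_on C2_on_inner_self)
  show ?thesis
    unfolding identification_hypotheses_def
  proof (intro conjI)
    show "differential_game ?g" "is_FNE ?g (radial_strategy 1)"
      by (simp_all add: radial_differential_game)
    show "\<forall>i<nplayers ?g. \<forall>j<nplayers ?g. diagonal_mat (ctrl_cost ?g i j)"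
      by (simp add: diagonal_mat_def)
    show "valid_demos ?g (radial_strategy 1) (radial_demos v)" by (rule radial_valid_demos)
    show "\<forall>i<nplayers ?g.
        (\<forall>e'. valid_demos ?g (radial_strategy 1) e' \<longrightarrow>
          mat_rank (M_u ?g radial_basis e' i) \<le> mat_rank (M_u ?g radial_basis (radial_demos v) i)) \<and>
        mat_rank (M_u ?g radial_basis (radial_demos v) i) < cdim ?g i * hrel (radial_basis :: 'n basis_data) i"
      unfolding rank_u by (simp add: radial_M_u_rank)
    show "\<forall>i<nplayers ?g. \<forall>ys. set ys \<subseteq> region ?g \<longrightarrow>
        mat_rank (M_HJB ?g radial_basis (radial_demos v) ys i) \<le>
        mat_rank (M_HJB ?g radial_basis (radial_demos v) [v, (1 / 2) *\<^sub>R v] i)"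
      unfolding rank_HJB by (simp add: radial_M_HJB_rank)
    show "\<forall>i<nplayers ?g. \<not> (\<exists>c\<in>carrier_vec (mdim (radial_basis :: 'n basis_data) i). \<forall>x\<in>region ?g.
        state_cost ?g i x = scalar_prod c (psi radial_basis i x))"
      using radial_cost_not_spanned by simp
    show "\<exists>A. SW_subalgebra (region ?g) A \<and>
        (\<forall>i<nplayers ?g. \<forall>l<mdim (radial_basis :: 'n basis_data) i. (\<lambda>x. psi radial_basis i x $ l) \<in> A)"
      using SW \<psi> by blast
    show "\<forall>i<nplayers ?g.
        (\<forall>x. phi radial_basis i (x :: real ^ 'n) \<in> carrier_vec (hdim (radial_basis :: 'n basis_data) i)) \<and>
        (\<forall>j<hdim (radial_basis :: 'n basis_data) i. C2_on (region ?g) (\<lambda>x. phi radial_basis i x $ j)) \<and>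
        split_basis ?g radial_basis i \<and>
        Matrix.vec 3 (\<lambda>j. if j = 0 then 1 else 0) \<in> carrier_vec (hdim (radial_basis :: 'n basis_data) i) \<and>
        value_function ?g (radial_strategy 1) i
          (\<lambda>x. scalar_prod (Matrix.vec 3 (\<lambda>j. if j = 0 then 1 else 0)) (phi radial_basis i x))"
      unfolding V
    proof (intro allI impI conjI)
      show "C2_on (region ?g) (\<lambda>x :: real ^ 'n. phi radial_basis i x $ j)"
        if "j < hdim (radial_basis :: 'n basis_data) i" for i j
        using that by (intro radial_basis_C2) simp
      show "value_function ?g (radial_strategy 1) i (\<lambda>x. 1 * inner x x)" for i
        by (rule radial_value_function) simp
    qed (simp_all add: split)
  qed (use v in auto)
qed

end

text \<open>That coincidence is not guaranteed is an existence claim: one instance satisfies all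
  hypotheses while the two equilibria differ for each player. The residual part is stated for
  arbitrary \<open>\<beta>\<close>, which includes the identified one.\<close>

theorem lemma5:
  shows
    "(\<forall>(g :: 'n::finite game) \<mu> b \<theta> e xs.
        identification_hypotheses g \<mu> b \<theta> e xs \<longrightarrow>
        (\<forall>\<beta>. (\<forall>i<nplayers g. \<beta> i \<in> carrier_vec (mdim b i)) \<longrightarrow>
          (\<exists>\<epsilon>. \<forall>i<nplayers g. residual_representation g \<mu> b i (\<beta> i) (\<theta> i) (\<epsilon> i)))) \<and>
     (\<exists>(g :: 'n game) \<mu> b \<theta> e xs \<epsilon> w \<alpha>' \<beta>' R' g' \<mu>' \<theta>'.
        identification_hypotheses g \<mu> b \<theta> e xs \<and>
        (\<forall>i<nplayers g.
           w i \<in> carrier_vec (cdim_total g + mdim b i + hdim b i) \<and>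
           \<alpha>' i \<in> carrier_vec (cdim_total g) \<and> \<beta>' i \<in> carrier_vec (mdim b i) \<and>
           \<alpha>' i @\<^sub>v \<beta>' i = HJB_solution g b e xs i (w i) \<and>
           residual_representation g \<mu> b i (\<beta>' i) (\<theta> i) (\<epsilon> i)) \<and>
        g' = g\<lparr>state_cost := (\<lambda>i x. scalar_prod (\<beta>' i) (psi b i x)), ctrl_cost := R'\<rparr> \<and>
        differential_game g' \<and>
        (\<forall>i<nplayers g. (\<forall>j<nplayers g. diagonal_mat (R' i j)) \<and> weight_diag g' i = \<alpha>' i) \<and>
        is_FNE g' \<mu>' \<and>
        (\<forall>i<nplayers g. \<theta>' i \<in> carrier_vec (hdim b i) \<and>
           value_function g' \<mu>' i (\<lambda>x. scalar_prod (\<theta>' i) (phi b i x))) \<and>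
        (\<forall>i<nplayers g. \<exists>x\<in>region g. \<mu>' i x \<noteq> \<mu> i x))"
proof (intro conjI allI impI)
  fix g :: "'n game" and \<mu> b \<theta> e xs and \<beta> :: "nat \<Rightarrow> real Matrix.vec"
  assume "identification_hypotheses g \<mu> b \<theta> e xs"
    and "\<forall>i<nplayers g. \<beta> i \<in> carrier_vec (mdim b i)"
  then show "\<exists>\<epsilon>. \<forall>i<nplayers g. residual_representation g \<mu> b i (\<beta> i) (\<theta> i) (\<epsilon> i)"
    by (intro exI[of _ "\<lambda>i x. state_cost g i x - scalar_prod (\<beta> i) (psi b i x)"])
      (auto intro: residual_representation_exists)
next
  obtain v :: "real ^ 'n" where v: "norm v = 1"
    using vector_choose_size[of 1] by auto
  let ?g = "radial_game (radial_cost 1) :: 'n game" and ?g' = "radial_game (radial_cost 2) :: 'n game"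
  \<comment> \<open>The points \<open>v\<close> and half of \<open>v\<close> serve both as initial
    states of the demonstrations and as data points for the cost.\<close>
  let ?b = "radial_basis :: 'n basis_data" and ?e = "radial_demos v" and ?xs = "[v, (1 / 2) *\<^sub>R v]"
  let ?\<theta> = "\<lambda>c (i :: nat). Matrix.vec 3 (\<lambda>j. if j = 0 then c else 0) :: real vec"
  let ?w = "\<lambda>i :: nat. vec_of_list [1, 4, 2, 1 / 4, 0] :: real vec"
  let ?\<alpha> = "\<lambda>i :: nat. vec_of_list [1] :: real vec" and ?\<beta> = "\<lambda>i :: nat. vec_of_list [4] :: real vec"
  let ?\<epsilon> = "\<lambda>i x. state_cost ?g i x - scalar_prod (?\<beta> i) (psi ?b i x)"
  have H: "identification_hypotheses ?g (radial_strategy 1) ?b (?\<theta> 1) ?e ?xs"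
    by (rule radial_identification_hypotheses[OF v])
  have \<beta>: "?\<beta> i \<in> carrier_vec (mdim ?b i)" for i by (simp add: carrier_vecI)
  have sol: "?\<alpha> i @\<^sub>v ?\<beta> i = HJB_solution ?g ?b ?e ?xs i (?w i)" for i
    unfolding radial_HJB_solution[OF v] using vec_of_list_append_vec[of "vec_of_list [1]" "[4]"]
    by (simp add: list_vec)
  have cost: "scalar_prod (?\<beta> i) (psi ?b i x) = radial_cost 2 x" for i x
    by (simp add: scalar_prod_def radial_cost_def)
  \<comment> \<open>The game built from the identified parameters is literally the radial game with
    \<open>k = 2\<close>.\<close>
  have g': "?g' = ?g\<lparr>state_cost := (\<lambda>i x. scalar_prod (?\<beta> i) (psi ?b i x)), ctrl_cost := (\<lambda>_ _. 1\<^sub>m 1)\<rparr>"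
    unfolding cost by (simp add: radial_game_def)
  have V: "(\<lambda>x. scalar_prod (?\<theta> 2 i) (phi ?b i x)) = (\<lambda>x. 2 * inner x x)" for i
    by (simp add: scalar_prod_def sum_upt_3)
  \<comment> \<open>At the unit vector \<open>v\<close> the two controls are -2 and -1.\<close>
  have diff: "\<exists>x\<in>region ?g. radial_strategy 2 i x \<noteq> radial_strategy 1 i x" for i
  proof
    have "inner v v = 1" using v by (simp add: dot_square_norm)
    then have "radial_strategy 2 i v $ 0 \<noteq> radial_strategy 1 i v $ 0" by simp
    then show "radial_strategy 2 i v \<noteq> radial_strategy 1 i v" by metis
  qed (use v in simp)
  have "identification_hypotheses ?g (radial_strategy 1) ?b (?\<theta> 1) ?e ?xs \<and>
      (\<forall>i<nplayers ?g.
         ?w i \<in> carrier_vec (cdim_total ?g + mdim ?b i + hdim ?b i) \<and>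
         ?\<alpha> i \<in> carrier_vec (cdim_total ?g) \<and> ?\<beta> i \<in> carrier_vec (mdim ?b i) \<and>
         ?\<alpha> i @\<^sub>v ?\<beta> i = HJB_solution ?g ?b ?e ?xs i (?w i) \<and>
         residual_representation ?g (radial_strategy 1) ?b i (?\<beta> i) (?\<theta> 1 i) (?\<epsilon> i)) \<and>
      ?g' = ?g\<lparr>state_cost := (\<lambda>i x. scalar_prod (?\<beta> i) (psi ?b i x)), ctrl_cost := (\<lambda>_ _. 1\<^sub>m 1)\<rparr> \<and>
      differential_game ?g' \<and>
      (\<forall>i<nplayers ?g. (\<forall>j<nplayers ?g. diagonal_mat (1\<^sub>m 1 :: real mat)) \<and> weight_diag ?g' i = ?\<alpha> i) \<and>
      is_FNE ?g' (radial_strategy 2) \<and>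
      (\<forall>i<nplayers ?g. ?\<theta> 2 i \<in> carrier_vec (hdim ?b i) \<and>
         value_function ?g' (radial_strategy 2) i (\<lambda>x. scalar_prod (?\<theta> 2 i) (phi ?b i x))) \<and>
      (\<forall>i<nplayers ?g. \<exists>x\<in>region ?g. radial_strategy 2 i x \<noteq> radial_strategy 1 i x)"
  proof (intro conjI allI impI)
    fix i assume i: "i < nplayers ?g"
    show "?w i \<in> carrier_vec (cdim_total ?g + mdim ?b i + hdim ?b i)" "?\<alpha> i \<in> carrier_vec (cdim_total ?g)"
      by (simp_all add: cdim_total_def carrier_vecI)
    show "residual_representation ?g (radial_strategy 1) ?b i (?\<beta> i) (?\<theta> 1 i) (?\<epsilon> i)"
      by (rule residual_representation_exists[OF H i \<beta>])
    show "weight_diag ?g' i = ?\<alpha> i"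
      by (simp add: weight_diag_def diag_mat_def)
    show "value_function ?g' (radial_strategy 2) i (\<lambda>x. scalar_prod (?\<theta> 2 i) (phi ?b i x))"
      unfolding V by (rule radial_value_function) simp
  next
    show "is_FNE ?g' (radial_strategy 2)" "differential_game ?g'"
      by (simp_all add: radial_differential_game)
  qed (rule H \<beta> sol g' diff | simp add: diagonal_mat_def)+
  then show "\<exists>(g :: 'n game) \<mu> b \<theta> e xs \<epsilon> w \<alpha>' \<beta>' R' g' \<mu>' \<theta>'.
        identification_hypotheses g \<mu> b \<theta> e xs \<and>
        (\<forall>i<nplayers g.
           w i \<in> carrier_vec (cdim_total g + mdim b i + hdim b i) \<and>
           \<alpha>' i \<in> carrier_vec (cdim_total g) \<and> \<beta>' i \<in> carrier_vec (mdim b i) \<and>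
           \<alpha>' i @\<^sub>v \<beta>' i = HJB_solution g b e xs i (w i) \<and>
           residual_representation g \<mu> b i (\<beta>' i) (\<theta> i) (\<epsilon> i)) \<and>
        g' = g\<lparr>state_cost := (\<lambda>i x. scalar_prod (\<beta>' i) (psi b i x)), ctrl_cost := R'\<rparr> \<and>
        differential_game g' \<and>
        (\<forall>i<nplayers g. (\<forall>j<nplayers g. diagonal_mat (R' i j)) \<and> weight_diag g' i = \<alpha>' i) \<and>
        is_FNE g' \<mu>' \<and>
        (\<forall>i<nplayers g. \<theta>' i \<in> carrier_vec (hdim b i) \<and>
           value_function g' \<mu>' i (\<lambda>x. scalar_prod (\<theta>' i) (phi b i x))) \<and>
        (\<forall>i<nplayers g. \<exists>x\<in>region g. \<mu>' i x \<noteq> \<mu> i x)"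
    by (intro exI)
qed

end
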